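(* Let $\alpha=(0,0,0,0)$ and let $\beta$ be any one of the four parameter vectors $$\left(\tfrac13,\tfrac13,\tfrac23,\tfrac23\right),\quad \left(\tfrac13,\tfrac23,\tfrac16,\tfrac56\right),\quad \left(\tfrac14,\tfrac14,\tfrac34,\tfrac34\right),\quad \left(\tfrac13,\tfrac23,\tfrac14,\tfrac34\right).$$ Then the hypergeometric monodromy group $\Gamma=\Gamma(\alpha,\beta)\subset \mathrm{Sp}_4(\Omega)(\mathbb{Z})$ associated to $(\alpha,\beta)$ is arithmetic, that is, $\Gamma$ has finite index in $\mathrm{Sp}_4(\Omega)(\mathbb{Z})$.
   Context: Hypergeometric equation. With $\theta=z\frac{d}{dz}$ and $\alpha,\beta\in\mathbb{C}^n$, put $D(\alpha;\beta)=(\theta+\beta_1-1)\cdots(\theta+\beta_n-1)-z(\theta+\alpha_1)\cdots(\theta+\alpha_n)$. The hypergeometric differential equation $D(\alpha;\beta)w=0$ on $\mathbb{P}^1(\mathbb{C})$ has regular singularities at $0,1,\infty$ and is regular elsewhere. Its monodromy group is the image in $\mathrm{GL}_n(\mathbb{C})$ of the action of $\pi_1(\mathbb{P}^1(\mathbb{C})\setminus\{0,1,\infty\})$ on the solution space. Description by companion matrices (Levelt's theorem). If $\alpha_j-\beta_k\notin\mathbb{Z}$ for all $j,k$ (which holds in all cases considered), then up to conjugation in $\mathrm{GL}_n(\mathbb{C})$ the monodromy group is the subgroup generated by the companion matrices $A$ and $B$ of $$f(X)=\prod_{j=1}^n (X-e^{2\pi i\alpha_j}),\qquad g(X)=\prod_{j=1}^n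 (X-e^{2\pi i\beta_j})$$ respectively. Here $n=4$, and the companion matrix of $X^4+c_3X^3+c_2X^2+c_1X+c_0$ is $$\begin{pmatrix}0&0&0&-c_0\\1&0&0&-c_1\\0&1&0&-c_2\\0&0&1&-c_3\end{pmatrix}.$$ Throughout, the monodromy group $\Gamma=\Gamma(\alpha,\beta)$ is identified with the subgroup $\langle A,B\rangle$ of $\mathrm{SL}_4(\mathbb{Z})$. The polynomials. For $\alpha=(0,0,0,0)$, $f(X)=(X-1)^4=X^4-4X^3+6X^2-4X+1$. For the four values of $\beta$, in the order listed in the claim, $g(X)$ is respectively $X^4+2X^3+3X^2+2X+1$, $X^4+X^2+1$, $X^4+2X^2+1$, $X^4+X^3+2X^2+X+1$. The symplectic form. By Beukers–Heckman, in each of these cases $\Gamma$ preserves a non-degenerate symplectic (alternating bilinear) form $\Omega$ on $\mathbb{Q}^4$, integral on $\mathbb{Z}^4$, and $\Gamma$ is Zariski dense in the symplectic group $\mathrm{Sp}_4(\Omega)$ of $\Omega$ (so $\Omega$ is unique up to a nonzero scalar). $\mathrm{Sp}_4(\Omega)(\mathbb{Z})$ denotes the group of matrices in $\mathrm{SL}_4(\mathbb{Z})$ preserving $\Omega$; thus $\Gamma\subset \mathrm{Sp}_4(\Omega)(\mathbb{Z})$. Arithmetic. $\Gamma$ is called arithmetic if it has finite index in $\mathrm{Sp}_4(\Omega)(\mathbb{Z})$, and thin otherwise. These four groups are among the 14 hypergeometric monodromy groups associated to Calabi–Yau threefolds. *)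

theory Defs
  imports
    "HOL-Analysis.Analysis"
    "HOL-Computational_Algebra.Polynomial"
    "HOL-Algebra.Coset"
    "HOL-Algebra.Generated_Groups"
begin

lemma vector_4 [simp]:
  "(vector [w, x, y, z] :: 'a::zero ^ 4) $ 1 = w"
  "(vector [w, x, y, z] :: 'a::zero ^ 4) $ 2 = x"
  "(vector [w, x, y, z] :: 'a::zero ^ 4) $ 3 = y"
  "(vector [w, x, y, z] :: 'a::zero ^ 4) $ 4 = z"
  unfolding vector_def by simp_all

definition exp_poly :: "complex ^ 4 \<Rightarrow> complex poly" where
  "exp_poly \<alpha> = (\<Prod>j\<in>UNIV. [:- exp (2 * of_real pi * \<i> * \<alpha> $ j), 1:])"

text \<open>Only meaningful for a monic polynomial of degree 4.\<close>

definition companion :: "'a::comm_ring_1 poly \<Rightarrow> 'a ^ 4 ^ 4" where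
  "companion p = vector
     [vector [0, 0, 0, - coeff p 0],
      vector [1, 0, 0, - coeff p 1],
      vector [0, 1, 0, - coeff p 2],
      vector [0, 0, 1, - coeff p 3]]"

definition GL4 :: "(complex ^ 4 ^ 4) monoid" where
  "GL4 = \<lparr>carrier = {M. invertible M}, monoid.mult = (**), one = mat 1\<rparr>"

text \<open>
  By Levelt's theorem the following group is, up to conjugation, the monodromy group of the
  hypergeometric equation \<open>D(\<alpha>;\<beta>) w = 0\<close> whenever no \<open>\<alpha>\<^sub>j - \<beta>\<^sub>k\<close> is an integer;
  this description is taken as the definition.
\<close>

definition hypergeometric_group :: "complex ^ 4 \<Rightarrow> complex ^ 4 \<Rightarrow> (complex ^ 4 ^ 4) set" where
  "hypergeometric_group \<alpha> \<beta> =
     generate GL4 {companion (exp_poly \<alpha>), companion (exp_poly \<beta>)}"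

definition symplectic_form :: "(rat ^ 4 \<Rightarrow> rat ^ 4 \<Rightarrow> rat) \<Rightarrow> bool" where
  "symplectic_form \<Omega> \<longleftrightarrow>
     (\<forall>u. Vector_Spaces.linear (*s) (*) (\<Omega> u)) \<and>
     (\<forall>v. Vector_Spaces.linear (*s) (*) (\<lambda>u. \<Omega> u v)) \<and>
     (\<forall>u. \<Omega> u u = 0) \<and>
     (\<forall>u. u \<noteq> 0 \<longrightarrow> (\<exists>v. \<Omega> u v \<noteq> 0))"

definition integral_form :: "(rat ^ 4 \<Rightarrow> rat ^ 4 \<Rightarrow> rat) \<Rightarrow> bool" where
  "integral_form \<Omega> \<longleftrightarrow> (\<forall>u v. (\<forall>i. u $ i \<in> \<int>) \<longrightarrow> (\<forall>i. v $ i \<in> \<int>) \<longrightarrow> \<Omega> u v \<in> \<int>)"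

definition preserves_form :: "(rat ^ 4 \<Rightarrow> rat ^ 4 \<Rightarrow> rat) \<Rightarrow> rat ^ 4 ^ 4 \<Rightarrow> bool" where
  "preserves_form \<Omega> M \<longleftrightarrow> (\<forall>u v. \<Omega> (M *v u) (M *v v) = \<Omega> u v)"

text \<open>
  The integral symplectic group is embedded in \<open>GL4\<close>, so that the inclusion of the
  hypergeometric group, whose elements are a priori complex matrices, also says that these
  have integer entries.
\<close>

definition Sp4Z :: "(rat ^ 4 \<Rightarrow> rat ^ 4 \<Rightarrow> rat) \<Rightarrow> (complex ^ 4 ^ 4) monoid" where
  "Sp4Z \<Omega> = GL4 \<lparr>carrier :=
     {map_matrix of_int M | M :: int ^ 4 ^ 4. det M = 1 \<and> preserves_form \<Omega> (map_matrix of_int M)}\<rparr>"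

text \<open>
  A symplectic form with respect to which the notion of arithmeticity of \<open>\<Gamma>\<close> makes sense.
  For Zariski dense \<open>\<Gamma>\<close> it is unique up to a scalar, and \<open>Sp4Z\<close> does not depend on the scalar.
\<close>

definition invariant_symplectic_form ::
    "(complex ^ 4 ^ 4) set \<Rightarrow> (rat ^ 4 \<Rightarrow> rat ^ 4 \<Rightarrow> rat) \<Rightarrow> bool" where
  "invariant_symplectic_form \<Gamma> \<Omega> \<longleftrightarrow>
     symplectic_form \<Omega> \<and> integral_form \<Omega> \<and> subgroup \<Gamma> (Sp4Z \<Omega>)"

definition arithmetic :: "(complex ^ 4 ^ 4) set \<Rightarrow> (rat ^ 4 \<Rightarrow> rat ^ 4 \<Rightarrow> rat) \<Rightarrow> bool" where
  "arithmetic \<Gamma> \<Omega> \<longleftrightarrow> finite (rcosets\<^bsub>Sp4Z \<Omega>\<^esub> \<Gamma>)"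

end

theory Submission
  imports Defs
begin

text \<open>
  All four groups belong to one family. After embedding \<open>\<int>\<^sup>4\<close> suitably as a sublattice of finite
  index into \<open>\<int>\<^sup>4\<close> with the standard symplectic form \<open>sp\<close>, the matrix \<open>A\<close> becomes a unipotent map
  \<open>shift d k\<close> with a single Jordan block, and \<open>A\<^sup>-\<^sup>1 B\<close> becomes the transvection \<open>x \<mapsto> x - sp x e \<cdot> e\<close> along \<open>e = (0, 0, 0, 1)\<close>; the
  parameters \<open>(d, k)\<close> are \<open>(9, 6)\<close>, \<open>(3, 4)\<close>, \<open>(4, 4)\<close> and \<open>(6, 5)\<close>. So \<open>\<Gamma>\<close> contains the transvection
  along every vector of the \<open>\<Gamma>\<close>-orbit of \<open>e\<close>, and the proof uses only such transvections.

  Two of them along orthogonal vectors \<open>y\<close> and \<open>y' = y + c \<cdot> v\<close> combine to a unipotent element of the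
  Heisenberg group attached to \<open>v\<close>, the unipotent radical of the stabiliser of \<open>v\<close>. Two independent such
  elements and their commutators give a finite-index subgroup of that Heisenberg group
  (\<open>heisenberg_lattice\<close>). This is achieved for two opposite vectors \<open>q\<^sub>1\<close> and \<open>q\<^sub>4\<close>. Moreover, some
  transvections along vectors of the orbit that are orthogonal to \<open>q\<^sub>1\<close> act on the rank 2 lattice
  \<open>q\<^sub>1\<^sup>\<bottom> / q\<^sub>1\<close> so richly that every primitive vector there can be shortened until only finitely many
  are left. For each of the four parameter pairs an explicit list of steps leading from \<open>e\<close> to the needed
  vectors is checked by computation (\<open>has_reducing_frame_9_6\<close> and its three companions).

  The two opposite Heisenberg groups are enough to move every primitive vector that is congruent to \<open>q\<^sub>1\<close>
  modulo a fixed integer back to \<open>q\<^sub>1\<close> (\<open>first_column_to_unit\<close>): a variant of the Euclidean algorithm in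
  which coprimality is produced first and then consumed. What remains is an element of the stabiliser of
  \<open>q\<^sub>1\<close>. Its action on \<open>q\<^sub>1\<^sup>\<bottom> / q\<^sub>1\<close> is brought into a finite set by the shortening procedure, and its
  Heisenberg part by translations (\<open>stabiliser_frames_bounded\<close>). Hence every element of a principal
  congruence subgroup of the integral symplectic group is, up to left multiplication by \<open>\<Gamma>\<close>, one of
  finitely many (\<open>frames_bounded\<close>). As congruence subgroups have finite index, so has \<open>\<Gamma>\<close>
  (\<open>finite_cosets\<close>).

  The statement concerns every invariant symplectic form. Invariance under \<open>A\<close> and \<open>B\<close> determines an
  alternating form up to a scalar (\<open>invariant_form_unique\<close>), so one form suffices.
\<close>

section \<open>The standard symplectic lattice\<close>

text \<open>Quadruples rather than vectors, so that the long computations below can be evaluated.\<close>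

type_synonym z4 = "int \<times> int \<times> int \<times> int"

definition sp :: "z4 \<Rightarrow> z4 \<Rightarrow> int" where
  "sp = (\<lambda>(x1, x2, x3, x4) (y1, y2, y3, y4). x1 * y4 - x4 * y1 + x2 * y3 - x3 * y2)"

lemma sp_simp [simp]:
  "sp (x1, x2, x3, x4) (y1, y2, y3, y4) = x1 * y4 - x4 * y1 + x2 * y3 - x3 * y2"
  by (simp add: sp_def)

text \<open>
  The two families below are the Heisenberg groups that fix \<open>(1, 0, 0, 0)\<close> and \<open>(0, 0, 0, 1)\<close>: the
  unipotent radicals of two opposite parabolic subgroups of the symplectic group.
\<close>

definition hplus :: "int \<Rightarrow> int \<Rightarrow> int \<Rightarrow> z4 \<Rightarrow> z4" where
  "hplus a b z = (\<lambda>(x1, x2, x3, x4). (x1 + a * x3 - b * x2 + z * x4, x2 + a * x4, x3 + b * x4, x4))"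

definition hminus :: "int \<Rightarrow> int \<Rightarrow> int \<Rightarrow> z4 \<Rightarrow> z4" where
  "hminus a b z = (\<lambda>(x1, x2, x3, x4). (x1, x2 + a * x1, x3 + b * x1, x4 + b * x2 - a * x3 + z * x1))"

text \<open>
  For a map \<open>g\<close> that fixes \<open>e = (1, 0, 0, 0)\<close> this describes the action of \<open>g\<close> on \<open>e\<^sup>\<bottom> / e\<close>, a lattice of
  rank 2 with coordinates \<open>x2, x3\<close>; the quadruple is the \<open>2 \<times> 2\<close> matrix of that action, row by row.
\<close>

definition acts_on_quotient :: "z4 \<Rightarrow> (z4 \<Rightarrow> z4) \<Rightarrow> bool" where
  "acts_on_quotient = (\<lambda>(a, b, c, d) g. g (1, 0, 0, 0) = (1, 0, 0, 0) \<and>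
     (\<forall>x1 x2 x3. \<exists>y. g (x1, x2, x3, 0) = (y, a * x2 + b * x3, c * x2 + d * x3, 0)))"

text \<open>The matrix of the transvection \<open>x \<mapsto> x + t \<cdot> det(x, v) \<cdot> v\<close> of the plane.\<close>

definition transv_matrix :: "int \<Rightarrow> int \<times> int \<Rightarrow> z4" where
  "transv_matrix t = (\<lambda>(v1, v2). (1 + t * v1 * v2, - (t * v1 * v1), t * v2 * v2, 1 - t * v1 * v2))"

definition matrix2_mult :: "z4 \<Rightarrow> z4 \<Rightarrow> z4" where
  "matrix2_mult = (\<lambda>(a, b, c, d) (a', b', c', d').
     (a * a' + b * c', a * b' + b * d', c * a' + d * c', c * b' + d * d'))"

abbreviation lifts :: "int \<Rightarrow> int \<times> int \<Rightarrow> (z4 \<Rightarrow> z4) \<Rightarrow> bool" where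
  "lifts t v g \<equiv> acts_on_quotient (transv_matrix t v) g"

lemma acts_on_quotient_comp:
  assumes "acts_on_quotient M g" and "acts_on_quotient M' h"
  shows "acts_on_quotient (matrix2_mult M M') (g \<circ> h)"
proof -
  obtain a b c d where M: "M = (a, b, c, d)" by (cases M)
  obtain a' b' c' d' where M': "M' = (a', b', c', d')" by (cases M')
  have "\<exists>y. (g \<circ> h) (x1, x2, x3, 0) =
     (y, (a * a' + b * c') * x2 + (a * b' + b * d') * x3, (c * a' + d * c') * x2 + (c * b' + d * d') * x3, 0)"
    for x1 x2 x3
  proof -
    obtain y where y: "h (x1, x2, x3, 0) = (y, a' * x2 + b' * x3, c' * x2 + d' * x3, 0)"
      using assms(2) unfolding M' acts_on_quotient_def case_prod_conv by blast
    obtain y' where "g (y, a' * x2 + b' * x3, c' * x2 + d' * x3, 0) =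
        (y', a * (a' * x2 + b' * x3) + b * (c' * x2 + d' * x3), c * (a' * x2 + b' * x3) + d * (c' * x2 + d' * x3), 0)"
      using assms(1) unfolding M acts_on_quotient_def case_prod_conv by blast
    then show ?thesis using y by (simp add: algebra_simps)
  qed
  then show ?thesis using assms by (simp add: M M' acts_on_quotient_def matrix2_mult_def)
qed

lemma acts_on_quotient_id: "acts_on_quotient (transv_matrix 0 v) id"
  by (cases v) (simp add: acts_on_quotient_def transv_matrix_def)

lemma lifts_comp: "lifts s v g \<Longrightarrow> lifts t v h \<Longrightarrow> lifts (s + t) v (g \<circ> h)"
proof -
  have "matrix2_mult (transv_matrix s v) (transv_matrix t v) = transv_matrix (s + t) v"
    by (cases v) (simp add: matrix2_mult_def transv_matrix_def algebra_simps)
  then show "lifts s v g \<Longrightarrow> lifts t v h \<Longrightarrow> lifts (s + t) v (g \<circ> h)"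
    using acts_on_quotient_comp by metis
qed

lemma lifts_apply:
  assumes "lifts t (v1, v2) g"
  obtains y where "g (x1, x2, x3, 0) =
    (y, x2 + t * (x2 * v2 - x3 * v1) * v1, x3 + t * (x2 * v2 - x3 * v1) * v2, 0)"
proof -
  obtain y where "g (x1, x2, x3, 0) = (y, (1 + t * v1 * v2) * x2 + - (t * v1 * v1) * x3,
      t * v2 * v2 * x2 + (1 - t * v1 * v2) * x3, 0)"
    using assms unfolding acts_on_quotient_def transv_matrix_def case_prod_conv by blast
  then show ?thesis by (intro that[of y]) (simp add: algebra_simps)
qed

lemma lifts_fix: "lifts t v g \<Longrightarrow> g (1, 0, 0, 0) = (1, 0, 0, 0)"
  by (cases v) (simp add: acts_on_quotient_def transv_matrix_def)

definition entries_le :: "int \<Rightarrow> z4 \<Rightarrow> bool" where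
  "entries_le C = (\<lambda>(x1, x2, x3, x4). \<bar>x1\<bar> \<le> C \<and> \<bar>x2\<bar> \<le> C \<and> \<bar>x3\<bar> \<le> C \<and> \<bar>x4\<bar> \<le> C)"

text \<open>
  The witness is the product of the primes dividing \<open>g\<close> but not \<open>a\<close>. A prime divisor of \<open>g\<close> then divides
  exactly one of \<open>a\<close> and \<open>x * b\<close>.
\<close>

lemma coprime_shift:
  fixes a b g :: int
  assumes "g \<noteq> 0" and "\<And>p. prime p \<Longrightarrow> p dvd a \<Longrightarrow> p dvd b \<Longrightarrow> p dvd g \<Longrightarrow> False"
  shows "\<exists>x. coprime (a + x * b) g"
proof -
  define S where "S = {p \<in> prime_factors g. \<not> p dvd a}"
  have fin: "finite S" by (simp add: S_def)
  define x where "x = \<Prod>S"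
  have "coprime (a + x * b) g"
  proof (rule ccontr)
    assume "\<not> coprime (a + x * b) g"
    then obtain p where p: "prime p" "p dvd a + x * b" "p dvd g"
      using not_coprimeE[of "a + x*b" g]
      by (metis assms(1) dvd_trans prime_divisor_exists dvd_0_left)
    have pf: "p \<in> prime_factors g" using p assms(1) by (simp add: in_prime_factors_iff)
    show False
    proof (cases "p dvd a")
      case True
      have "\<not> p dvd x"
      proof
        assume "p dvd x"
        then obtain q where "q \<in> S" "p dvd q"
          using prime_dvd_prod_iff[OF fin p(1), of "\<lambda>q. q"] by (auto simp: x_def)
        then show False using True p(1)
          by (auto simp: S_def primes_dvd_imp_eq in_prime_factors_iff dest: primes_dvd_imp_eq)
      qed
      moreover have "p dvd x * b" using True p(2) by (simp add: dvd_add_right_iff)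
      ultimately have "p dvd b" using p(1) by (simp add: prime_dvd_mult_iff)
      then show False using assms(2) p True by blast
    next
      case False
      then have "p \<in> S" using pf by (simp add: S_def)
      then have "p dvd x" unfolding x_def using fin by (simp add: dvd_prod_eqI)
      then have "p dvd x * b" by simp
      then show False using p(2) False by (simp add: dvd_add_left_iff)
    qed
  qed
  then show ?thesis by blast
qed

section \<open>Reduction of symplectic frames\<close>

text \<open>
  The properties of \<open>\<Gamma>\<close> that give finite index. The last assumption says that the transvections along \<open>V\<close>
  shorten every vector \<open>(p, q)\<close> that is not a multiple of an element of \<open>V\<close>: adding
  \<open>\<plusminus> m w \<cdot> v\<close> with \<open>w = p v2 - q v1\<close> changes \<open>p\<^sup>2 + q\<^sup>2\<close> by
  \<open>\<plusminus> 2 m w b + m\<^sup>2 w\<^sup>2 \<bar>v\<bar>\<^sup>2\<close> with \<open>b = p v1 + q v2\<close>, which is negative for the right sign if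
  \<open>m \<bar>w\<bar> \<bar>v\<bar>\<^sup>2 < 2 \<bar>b\<bar>\<close>.
\<close>

locale reducing_monoid =
  fixes G :: "(z4 \<Rightarrow> z4) set" and N :: int and m :: int and V :: "(int \<times> int) set"
  assumes id_G: "id \<in> G"
    and comp_G: "g \<in> G \<Longrightarrow> h \<in> G \<Longrightarrow> g \<circ> h \<in> G"
    and sp_G: "g \<in> G \<Longrightarrow> sp (g x) (g y) = sp x y"
    and N: "N \<ge> 2"
    and m: "m > 0"
    and hplus_G: "hplus (N * a) (N * b) (N * c) \<in> G"
    and hminus_G: "hminus (N * a) (N * b) (N * c) \<in> G"
    and finite_V: "finite V"
    and coprime_V: "(v1, v2) \<in> V \<Longrightarrow> coprime v1 v2"
    and lift_pos: "v \<in> V \<Longrightarrow> \<exists>g\<in>G. lifts m v g"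
    and lift_neg: "v \<in> V \<Longrightarrow> \<exists>g\<in>G. lifts (- m) v g"
    and reduce_V: "\<exists>(v1, v2)\<in>V. p * v2 - q * v1 = 0 \<or>
      m * \<bar>p * v2 - q * v1\<bar> * (v1\<^sup>2 + v2\<^sup>2) < 2 * \<bar>p * v1 + q * v2\<bar>"
begin

text \<open>
  Write \<open>(A, B, C, D)\<close> for the vector. An element fixing \<open>(1, 0, 0, 0)\<close> makes \<open>A, B, C\<close> coprime, by
  adding a multiple of \<open>D\<close> to \<open>B\<close>. An element fixing \<open>(0, 0, 0, 1)\<close> adds multiples of \<open>A\<close> to \<open>B\<close> and
  \<open>C\<close> and makes \<open>B / N\<close> and \<open>C / N\<close> coprime. Therefore some combination of \<open>N B\<close> and \<open>N C\<close> equals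
  \<open>1 - A\<close>, which is a multiple of \<open>N\<^sup>2\<close>; adding it turns \<open>A\<close> into 1. Finally the other
  entries, all divisible by \<open>N\<close>, are cleared with the help of that 1.
\<close>

lemma first_column_to_unit:
  assumes A: "N\<^sup>2 dvd A - 1" and B: "N dvd B" and C: "N dvd C" and D: "N dvd D"
    and unim: "A * p + B * q + C * r + D * s = 1"
  shows "\<exists>g\<in>G. g (A, B, C, D) = (1, 0, 0, 0)"
proof -
  have NN: "N dvd A - 1" using A by (metis dvd_mult_left power2_eq_square)
  have A0: "A \<noteq> 0"
  proof
    assume "A = 0"
    then have "N dvd 1" using NN by (simp add: dvd_diff_commute)
    then show False using N by (simp add: zdvd1_eq)
  qed
  have noN: False if "prime l" "l dvd A" "l dvd N" for l :: int
  proof -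
    have "l dvd A - 1" using that(3) NN by (rule dvd_trans)
    then have "l dvd A - (A - 1)" using that(2) by (rule dvd_diff[rotated])
    then have "l dvd 1" by simp
    then show False using that(1) not_prime_unit by blast
  qed
  have "\<exists>x. coprime (B + x * (N * D)) (gcd A C)"
  proof (rule coprime_shift)
    show "gcd A C \<noteq> 0" using A0 by simp
    fix l :: int assume l: "prime l" "l dvd B" "l dvd N * D" "l dvd gcd A C"
    then have "l dvd D" using noN prime_dvd_mult_iff[OF l(1)] by auto
    then have "l dvd A * p + B * q + C * r + D * s" using l by (intro dvd_add) auto
    then show False using unim l(1) not_prime_unit by auto
  qed
  then obtain x where x: "coprime (B + x * (N * D)) (gcd A C)" by blast
  define A1 where "A1 = A + N * x * C"
  define B1 where "B1 = B + N * x * D"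
  have h1: "hplus (N * x) (N * 0) (N * 0) (A, B, C, D) = (A1, B1, C, D)"
    by (simp add: hplus_def A1_def B1_def)
  have cop1: "l dvd 1" if "l dvd A1" "l dvd B1" "l dvd C" for l
  proof -
    have "l dvd A" using that(1,3) by (simp add: A1_def dvd_add_left_iff)
    then have "l dvd gcd A C" using that(3) by simp
    moreover have "l dvd B + x * (N * D)" using that(2) by (simp add: B1_def algebra_simps)
    ultimately show ?thesis using x coprime_common_divisor by blast
  qed
  have A1: "N\<^sup>2 dvd A1 - 1"
  proof -
    have "N\<^sup>2 dvd N * x * C" using C by (auto simp: power2_eq_square elim!: dvdE)
    then have "N\<^sup>2 dvd (A - 1) + N * x * C" using A by (rule dvd_add[rotated])
    then show ?thesis by (simp add: A1_def algebra_simps)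
  qed
  have NN1: "N dvd A1 - 1" using A1 by (metis dvd_mult_left power2_eq_square)
  have A10: "A1 \<noteq> 0"
  proof
    assume "A1 = 0"
    then have "N dvd 1" using NN1 by (simp add: dvd_diff_commute)
    then show False using N by (simp add: zdvd1_eq)
  qed
  obtain b where b: "B1 = N * b" using B by (auto simp: B1_def elim!: dvdE intro: that[of "_ + x * D"] simp: algebra_simps)
  obtain c where c: "C = N * c" using C by (auto elim!: dvdE)
  \<comment> \<open>The shift by \<open>u\<close> only serves to make the modulus \<open>b1\<close> nonzero.\<close>
  define u :: int where "u = (if b = 0 then 1 else 0)"
  define b1 where "b1 = b + u * A1"
  have b1: "b1 \<noteq> 0" using A10 by (simp add: b1_def u_def)
  have "\<exists>y. coprime (c + y * A1) b1"
  proof (rule coprime_shift[OF b1])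
    fix l :: int assume l: "prime l" "l dvd c" "l dvd A1" "l dvd b1"
    then have "l dvd b" by (simp add: b1_def dvd_add_left_iff)
    then have "l dvd 1" using cop1 l by (simp add: b c)
    then show False using l(1) not_prime_unit by blast
  qed
  then obtain y where y: "coprime (c + y * A1) b1" by blast
  define c1 where "c1 = c + y * A1"
  define D2 where "D2 = D + N * y * B1 - N * u * C"
  have h2: "hminus (N * u) (N * y) (N * 0) (A1, B1, C, D) = (A1, N * b1, N * c1, D2)"
    by (simp add: hminus_def b c b1_def c1_def D2_def algebra_simps)
  have D2: "N dvd D2" using D unfolding D2_def by (simp add: mult.assoc)
  obtain k where k: "A1 - 1 = N\<^sup>2 * k" using A1 by (auto elim!: dvdE)
  obtain e f where ef: "e * c1 + f * b1 = 1"
    using y bezout_int[of c1 b1] unfolding c1_def[symmetric] by (auto simp: coprime_iff_gcd_eq_1)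
  define a' where "a' = - k * e"
  define b' where "b' = k * f"
  have A3: "A1 + N * a' * (N * c1) - N * b' * (N * b1) = 1"
  proof -
    have "A1 + N * a' * (N * c1) - N * b' * (N * b1) = A1 - N\<^sup>2 * k * (e * c1 + f * b1)"
      by (simp add: a'_def b'_def power2_eq_square algebra_simps)
    then show ?thesis using k ef by simp
  qed
  have h3: "hplus (N * a') (N * b') (N * 0) (A1, N * b1, N * c1, D2)
     = (1, N * (b1 + a' * D2), N * (c1 + b' * D2), D2)"
    using A3 by (simp add: hplus_def algebra_simps)
  define b3 where "b3 = b1 + a' * D2"
  define c3 where "c3 = c1 + b' * D2"
  obtain d where d: "D2 = N * d" using D2 by (auto elim!: dvdE)
  have h4: "\<exists>d'. hminus (N * - b3) (N * - c3) (N * 0) (1, N * b3, N * c3, D2) = (1, 0, 0, N * d')"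
    by (rule exI[of _ "d - c3 * (N * b3) + b3 * (N * c3)"]) (simp add: hminus_def d algebra_simps)
  then obtain d' where d': "hminus (N * - b3) (N * - c3) (N * 0) (1, N * b3, N * c3, D2) = (1, 0, 0, N * d')" ..
  have h5: "hminus (N * 0) (N * 0) (N * - d') (1, 0, 0, N * d') = (1, 0, 0, 0)"
    by (simp add: hminus_def)
  let ?g = "hminus (N * 0) (N * 0) (N * - d') \<circ> (hminus (N * - b3) (N * - c3) (N * 0) \<circ>
     (hplus (N * a') (N * b') (N * 0) \<circ> (hminus (N * u) (N * y) (N * 0) \<circ> hplus (N * x) (N * 0) (N * 0))))"
  have "?g \<in> G" by (intro comp_G hplus_G hminus_G)
  moreover have "?g (A, B, C, D) = (1, 0, 0, 0)"
    unfolding comp_apply h1 h2 h3 b3_def[symmetric] c3_def[symmetric] d' h5 ..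
  ultimately show ?thesis by blast
qed

lemma lift_power: "v \<in> V \<Longrightarrow> \<exists>g\<in>G. lifts (n * m) v g"
proof -
  assume v: "v \<in> V"
  have pos: "\<exists>g\<in>G. lifts (int k * m) v g" for k
  proof (induction k)
    case 0
    show ?case using id_G acts_on_quotient_id[of v] by auto
  next
    case (Suc k)
    then show ?case using lift_pos[OF v] comp_G lifts_comp
      by (metis of_nat_Suc distrib_right mult_1)
  qed
  have neg: "\<exists>g\<in>G. lifts (- (int k * m)) v g" for k
  proof (induction k)
    case 0
    then show ?case using pos[of 0] by simp
  next
    case (Suc k)
    then obtain g where g: "g \<in> G" "lifts (- (int k * m)) v g" by blast
    obtain h where h: "h \<in> G" "lifts (- m) v h" using lift_neg[OF v] by blast
    have "lifts (- m + - (int k * m)) v (h \<circ> g)" by (rule lifts_comp[OF h(2) g(2)])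
    moreover have "- m + - (int k * m) = - (int (Suc k) * m)" by (simp add: algebra_simps)
    ultimately show ?case using comp_G[OF h(1) g(1)] by auto
  qed
  show ?thesis
  proof (cases "n \<ge> 0")
    case True then show ?thesis using pos[of "nat n"] by simp
  next
    case False then show ?thesis using neg[of "nat (- n)"] by simp
  qed
qed

text \<open>
  Descent on \<open>p\<^sup>2 + q\<^sup>2\<close>. It stops at a primitive multiple of some \<open>v \<in> V\<close>, hence at \<open>\<plusminus> v\<close>.
\<close>

lemma second_column_direction:
  "coprime p q \<Longrightarrow> \<exists>g\<in>G. g (1, 0, 0, 0) = (1, 0, 0, 0) \<and>
     (\<exists>y v1 v2. (v1, v2) \<in> V \<and> (g (x, p, q, 0) = (y, v1, v2, 0) \<or> g (x, p, q, 0) = (y, - v1, - v2, 0)))"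
proof (induction "nat (p\<^sup>2 + q\<^sup>2)" arbitrary: x p q rule: less_induct)
  case less
  obtain v1 v2 where v: "(v1, v2) \<in> V" and red: "p * v2 - q * v1 = 0 \<or>
      m * \<bar>p * v2 - q * v1\<bar> * (v1\<^sup>2 + v2\<^sup>2) < 2 * \<bar>p * v1 + q * v2\<bar>"
    using reduce_V[of p q] by auto
  define w where "w = p * v2 - q * v1"
  define b where "b = p * v1 + q * v2"
  define n where "n = v1\<^sup>2 + v2\<^sup>2"
  show ?case
  proof (cases "w = 0")
    case True
    then have eq: "p * v2 = q * v1" by (simp add: w_def)
    have cv: "coprime v1 v2" by (rule coprime_V[OF v])
    have "p dvd q * v1" using dvd_triv_left[of p v2] unfolding eq .
    then have "p dvd v1" using coprime_dvd_mult_right_iff[OF less.prems] by blast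
    moreover have "v1 dvd p * v2" using dvd_triv_right[of v1 q] unfolding eq .
    then have "v1 dvd p" using coprime_dvd_mult_left_iff[OF cv] by blast
    ultimately have p: "\<bar>p\<bar> = \<bar>v1\<bar>" by (rule zdvd_antisym_abs)
    have qp: "coprime q p" "coprime v2 v1" using less.prems cv by (simp_all add: coprime_commute)
    have "q dvd p * v2" using dvd_triv_left[of q v1] unfolding eq .
    then have "q dvd v2" using coprime_dvd_mult_right_iff[OF qp(1)] by blast
    moreover have "v2 dvd q * v1" using dvd_triv_right[of v2 p] unfolding eq .
    then have "v2 dvd q" using coprime_dvd_mult_left_iff[OF qp(2)] by blast
    ultimately have q: "\<bar>q\<bar> = \<bar>v2\<bar>" by (rule zdvd_antisym_abs)
    have "(p = v1 \<and> q = v2) \<or> (p = - v1 \<and> q = - v2)"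
    proof (cases "v1 = 0 \<or> v2 = 0")
      case True then show ?thesis using p q by (auto simp: abs_if split: if_splits)
    next
      case False then show ?thesis using p q eq by (auto simp: abs_if split: if_splits)
    qed
    then show ?thesis using id_G v by (intro bexI[of _ id]) auto
  next
    case False
    then have red': "m * \<bar>w\<bar> * n < 2 * \<bar>b\<bar>" using red by (simp add: w_def b_def n_def)
    have "\<exists>e. (e = 1 \<or> e = -1) \<and> e * (w * b) = - (\<bar>w\<bar> * \<bar>b\<bar>)"
      by (cases "w * b \<ge> 0") (auto simp: abs_mult[symmetric])
    then obtain e :: int where e: "e = 1 \<or> e = -1" "e * (w * b) = - (\<bar>w\<bar> * \<bar>b\<bar>)" by blast
    obtain g where g: "g \<in> G" "lifts (e * m) (v1, v2) g"
      using lift_power[OF v] by blast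
    define p' where "p' = p + e * m * w * v1"
    define q' where "q' = q + e * m * w * v2"
    obtain y where y: "g (x, p, q, 0) = (y, p', q', 0)"
      using lifts_apply[OF g(2)] unfolding p'_def q'_def w_def by metis
    have e2: "e * e = 1" using e(1) by auto
    have "p'\<^sup>2 + q'\<^sup>2 = p\<^sup>2 + q\<^sup>2 + 2 * m * (e * (w * b)) + (e * e) * m\<^sup>2 * w\<^sup>2 * n"
      unfolding p'_def q'_def b_def n_def power2_eq_square by (simp add: algebra_simps)
    also have "\<dots> = p\<^sup>2 + q\<^sup>2 - m * \<bar>w\<bar> * (2 * \<bar>b\<bar> - m * \<bar>w\<bar> * n)"
    proof -
      have "w\<^sup>2 = \<bar>w\<bar> * \<bar>w\<bar>" by (simp add: power2_eq_square)
      then show ?thesis unfolding e(2) e2 by (simp add: power2_eq_square algebra_simps)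
    qed
    also have "\<dots> < p\<^sup>2 + q\<^sup>2"
      using red' m False by simp
    finally have less': "p'\<^sup>2 + q'\<^sup>2 < p\<^sup>2 + q\<^sup>2" .
    then have "nat (p'\<^sup>2 + q'\<^sup>2) < nat (p\<^sup>2 + q\<^sup>2)"
      by (subst nat_less_eq_zless) simp_all
    moreover have "coprime p' q'"
    proof (rule coprimeI)
      fix l assume l: "l dvd p'" "l dvd q'"
      have "p' * v2 - q' * v1 = w" by (simp add: p'_def q'_def w_def algebra_simps)
      moreover have "l dvd p' * v2 - q' * v1" using l by (intro dvd_diff dvd_mult2)
      ultimately have lw: "l dvd w" by simp
      have "p = p' - w * (e * m * v1)" "q = q' - w * (e * m * v2)" by (simp_all add: p'_def q'_def)
      moreover have "l dvd p' - w * (e * m * v1)" "l dvd q' - w * (e * m * v2)"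
        using l lw by (simp_all only: dvd_diff dvd_mult2)
      ultimately have "l dvd p" "l dvd q" by simp_all
      then show "is_unit l" by (rule coprime_common_divisor[OF less.prems])
    qed
    ultimately have "\<exists>h\<in>G. h (1, 0, 0, 0) = (1, 0, 0, 0) \<and> (\<exists>z v1 v2. (v1, v2) \<in> V \<and>
        (h (y, p', q', 0) = (z, v1, v2, 0) \<or> h (y, p', q', 0) = (z, - v1, - v2, 0)))"
      by (rule less.hyps)
    then obtain h where h: "h \<in> G" "h (1, 0, 0, 0) = (1, 0, 0, 0)"
      "\<exists>z v1 v2. (v1, v2) \<in> V \<and> (h (y, p', q', 0) = (z, v1, v2, 0) \<or> h (y, p', q', 0) = (z, - v1, - v2, 0))"
      by blast
    have "(h \<circ> g) (1, 0, 0, 0) = (1, 0, 0, 0)" using lifts_fix[OF g(2)] h(2) by simp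
    then show ?thesis using h(3) y comp_G[OF h(1) g(1)] by (intro bexI[of _ "h \<circ> g"]) auto
  qed
qed

text \<open>
  For an element of the stabiliser of \<open>(1, 0, 0, 0)\<close> with columns \<open>c2, c3, c4\<close>. The middle entries of
  \<open>c2\<close> are brought to \<open>\<plusminus> v\<close> with \<open>v \<in> V\<close>. Powers of the transvection along \<open>v\<close> do not change
  them, but add multiples of \<open>m v\<close> to the middle entries of \<open>c3\<close>, which bounds their
  component along \<open>v\<close>; the component across \<open>v\<close> is bounded as the determinant is 1. Elements of the
  Heisenberg group then bound the first entries of \<open>c2\<close> and \<open>c3\<close> modulo \<open>N\<close>, the orthogonality
  relations bound the middle entries of \<open>c4\<close>, and the centre of the Heisenberg group bounds its first entry.
\<close>

lemma stabiliser_frames_bounded: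
  "\<exists>C. \<forall>c2 c3 c4. sp (1, 0, 0, 0) c2 = 0 \<and> sp (1, 0, 0, 0) c3 = 0 \<and> sp (1, 0, 0, 0) c4 = 1 \<and>
     sp c2 c3 = 1 \<and> sp c2 c4 = 0 \<and> sp c3 c4 = 0 \<longrightarrow>
     (\<exists>g\<in>G. g (1, 0, 0, 0) = (1, 0, 0, 0) \<and> entries_le C (g c2) \<and> entries_le C (g c3) \<and> entries_le C (g c4))"
proof -
  let ?Q = "\<lambda>v :: int \<times> int. (fst v)\<^sup>2 + (snd v)\<^sup>2"
  define C1 where "C1 = (\<Sum>v\<in>V. (m * ?Q v)\<^sup>2 + 1 + ?Q v)"
  have C1: "(m * ?Q v)\<^sup>2 + 1 + ?Q v \<le> C1" if "v \<in> V" for v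
    unfolding C1_def using that finite_V
    by (intro member_le_sum) auto
  define C where "C = 1 + N + C1 + 2 * (C1 * N)"
  show ?thesis
  proof (intro exI[of _ C] allI impI)
    fix c2 c3 c4
    assume asm: "sp (1, 0, 0, 0) c2 = 0 \<and> sp (1, 0, 0, 0) c3 = 0 \<and> sp (1, 0, 0, 0) c4 = 1 \<and>
     sp c2 c3 = 1 \<and> sp c2 c4 = 0 \<and> sp c3 c4 = 0"
    obtain a2 p q where c2: "c2 = (a2, p, q, 0)" using asm by (cases c2) auto
    obtain a3 p' q' where c3: "c3 = (a3, p', q', 0)" using asm by (cases c3) auto
    have "p * q' - q * p' = 1" using asm c2 c3 by simp
    then have "coprime p q"
      by (metis coprimeI dvd_diff dvd_mult2)
    then obtain g1 y v1 v2 e where g1: "g1 \<in> G" "g1 (1, 0, 0, 0) = (1, 0, 0, 0)" and v: "(v1, v2) \<in> V"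
      and e: "e = 1 \<or> e = (-1 :: int)" and g1c2: "g1 c2 = (y, e * v1, e * v2, 0)"
      using second_column_direction[of p q a2] unfolding c2
      by (metis mult_1 mult_minus1)
    obtain y3 p1 q1 where g1c3: "g1 c3 = (y3, p1, q1, 0)"
    proof -
      have "sp (1, 0, 0, 0) (g1 c3) = 0" using sp_G[OF g1(1), of "(1, 0, 0, 0)" c3] g1(2) asm by simp
      then show ?thesis using that by (cases "g1 c3") auto
    qed
    have det1: "e * v1 * q1 - e * v2 * p1 = 1"
      using sp_G[OF g1(1), of c2 c3] asm by (simp add: g1c2 g1c3)
    define Q where "Q = v1\<^sup>2 + v2\<^sup>2"
    have Q0: "Q > 0"
    proof -
      have "v1 \<noteq> 0 \<or> v2 \<noteq> 0" using det1 by auto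
      then show ?thesis by (simp add: Q_def sum_power2_gt_zero_iff)
    qed
    define b where "b = p1 * v1 + q1 * v2"
    define n where "n = b div (m * Q)"
    obtain g2 where g2: "g2 \<in> G" "lifts (e * n * m) (v1, v2) g2"
      using lift_power[OF v, of "e * n"] by blast
    have e2: "e * e = 1" using e by auto
    have w: "p1 * v2 - q1 * v1 = - e"
    proof -
      have "e * (e * v1 * q1 - e * v2 * p1) = e" using det1 by simp
      then have "(e * e) * (v1 * q1 - v2 * p1) = e" by (simp add: algebra_simps)
      then show ?thesis by (simp add: e2 algebra_simps)
    qed
    obtain y2 where g2c2: "g2 (g1 c2) = (y2, e * v1, e * v2, 0)"
    proof -
      obtain z where "g2 (y, e * v1, e * v2, 0) = (z, e * v1 + e * n * m * (e * v1 * v2 - e * v2 * v1) * v1,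
          e * v2 + e * n * m * (e * v1 * v2 - e * v2 * v1) * v2, 0)"
        by (rule lifts_apply[OF g2(2)])
      then show ?thesis using that by (simp add: g1c2 mult.commute mult.left_commute)
    qed
    define p2 where "p2 = p1 - n * m * v1"
    define q2 where "q2 = q1 - n * m * v2"
    obtain y4 where g2c3: "g2 (g1 c3) = (y4, p2, q2, 0)"
    proof -
      have "\<exists>y. g2 (y3, p1, q1, 0) = (y, p1 + e * n * m * (p1 * v2 - q1 * v1) * v1,
          q1 + e * n * m * (p1 * v2 - q1 * v1) * v2, 0)"
        using lifts_apply[OF g2(2)] by metis
      then obtain y where "g2 (g1 c3) = (y, p1 + e * n * m * (- e) * v1, q1 + e * n * m * (- e) * v2, 0)"
        unfolding g1c3 w by blast
      moreover have "e * n * m * (- e) * k = - (n * m * k)" for k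
      proof -
        have "e * n * m * (- e) * k = - ((e * e) * (n * m * k))" by (simp only: mult_ac mult_minus_left mult_minus_right)
        then show ?thesis by (simp only: e2 mult_1)
      qed
      ultimately show ?thesis using that by (simp add: p2_def q2_def)
    qed
    have det2: "e * v1 * q2 - e * v2 * p2 = 1"
      using det1 by (simp add: p2_def q2_def algebra_simps)
    have b2: "p2 * v1 + q2 * v2 = b mod (m * Q)"
    proof -
      have "p2 * v1 + q2 * v2 = b - (m * Q) * n"
        by (simp add: p2_def q2_def b_def Q_def power2_eq_square algebra_simps)
      then show ?thesis by (simp add: n_def minus_mult_div_eq_mod)
    qed
    have "(m * Q)\<^sup>2 + 1 + Q \<le> C1" using C1[OF v] by (simp add: Q_def)
    then have vQ: "v1\<^sup>2 + v2\<^sup>2 \<le> C1" "(m * Q)\<^sup>2 + 1 \<le> C1"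
      using Q0 zero_le_power2[of "m * Q"] unfolding Q_def by linarith+
    have sq: "\<bar>z\<bar> \<le> z\<^sup>2" for z :: int
    proof (cases "z = 0")
      case False
      then have "\<bar>z\<bar> * 1 \<le> \<bar>z\<bar> * \<bar>z\<bar>" by (intro mult_left_mono) auto
      then show ?thesis by (simp add: power2_eq_square)
    qed simp
    have vb: "\<bar>v1\<bar> \<le> C1" "\<bar>v2\<bar> \<le> C1"
      using vQ(1) sq[of v1] sq[of v2] zero_le_power2[of v1] zero_le_power2[of v2] by linarith+
    have pq2: "p2\<^sup>2 + q2\<^sup>2 \<le> C1"
    proof -
      have "0 \<le> b mod (m * Q)" "b mod (m * Q) \<le> m * Q" using m Q0 by (simp_all add: order_less_imp_le)
      then have "(b mod (m * Q))\<^sup>2 \<le> (m * Q)\<^sup>2" by (intro power_mono)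
      \<comment> \<open>Lagrange's identity: the squares of the components along and across \<open>v\<close> add up.\<close>
      moreover have "Q * (p2\<^sup>2 + q2\<^sup>2) = (p2 * v1 + q2 * v2)\<^sup>2 + (e * v1 * q2 - e * v2 * p2)\<^sup>2"
      proof -
        have "(p2 * v1 + q2 * v2)\<^sup>2 + (e * v1 * q2 - e * v2 * p2)\<^sup>2 = (p2 * v1 + q2 * v2)\<^sup>2 + (e * e) * (v1 * q2 - v2 * p2)\<^sup>2"
          by (simp add: power2_eq_square algebra_simps)
        also have "\<dots> = Q * (p2\<^sup>2 + q2\<^sup>2)"
          by (simp add: e2 Q_def power2_eq_square algebra_simps)
        finally show ?thesis by simp
      qed
      ultimately have "Q * (p2\<^sup>2 + q2\<^sup>2) \<le> C1" using vQ(2) b2 det2 by simp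
      moreover have "1 * (p2\<^sup>2 + q2\<^sup>2) \<le> Q * (p2\<^sup>2 + q2\<^sup>2)"
        using Q0 by (intro mult_right_mono) auto
      ultimately show ?thesis unfolding mult_1 by (rule order_trans[rotated])
    qed
    have pqb: "\<bar>p2\<bar> \<le> C1" "\<bar>q2\<bar> \<le> C1"
      using pq2 sq[of p2] sq[of q2] zero_le_power2[of p2] zero_le_power2[of q2] by linarith+
    define P where "P = e * v1"
    define P' where "P' = e * v2"
    have PP: "\<bar>P\<bar> \<le> C1" "\<bar>P'\<bar> \<le> C1" using vb e by (auto simp: P_def P'_def)
    have det: "P * q2 - P' * p2 = 1" using det2 by (simp add: P_def P'_def)
    define s where "s = - (y2 div N)"
    define t where "t = - (y4 div N)"
    define a where "a = P * t - p2 * s"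
    define b' where "b' = P' * t - q2 * s"
    have s: "a * P' - b' * P = s" 
    proof -
      have "a * P' - b' * P = s * (P * q2 - P' * p2)" by (simp add: a_def b'_def algebra_simps)
      then show ?thesis using det by simp
    qed
    have t: "a * q2 - b' * p2 = t"
    proof -
      have "a * q2 - b' * p2 = t * (P * q2 - P' * p2)" by (simp add: a_def b'_def algebra_simps)
      then show ?thesis using det by simp
    qed
    let ?g3 = "hplus (N * a) (N * b') (N * 0)"
    have g3c2: "?g3 (g2 (g1 c2)) = (y2 mod N, P, P', 0)"
    proof -
      have "y2 + N * a * P' - N * b' * P = y2 + N * (a * P' - b' * P)"
        by (simp add: algebra_simps)
      also have "\<dots> = y2 + N * s" unfolding s ..
      also have "\<dots> = y2 mod N" by (simp add: s_def minus_mult_div_eq_mod)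
      finally show ?thesis unfolding g2c2 by (simp add: hplus_def P_def P'_def)
    qed
    have g3c3: "?g3 (g2 (g1 c3)) = (y4 mod N, p2, q2, 0)"
    proof -
      have "y4 + N * a * q2 - N * b' * p2 = y4 + N * (a * q2 - b' * p2)"
        by (simp add: algebra_simps)
      also have "\<dots> = y4 + N * t" unfolding t ..
      also have "\<dots> = y4 mod N" by (simp add: t_def minus_mult_div_eq_mod)
      finally show ?thesis unfolding g2c3 by (simp add: hplus_def)
    qed
    have g2e: "g2 (1, 0, 0, 0) = (1, 0, 0, 0)" by (rule lifts_fix[OF g2(2)])
    define g3 where "g3 = ?g3 \<circ> (g2 \<circ> g1)"
    have g3: "g3 \<in> G" unfolding g3_def by (intro comp_G hplus_G g2 g1)
    have g3e: "g3 (1, 0, 0, 0) = (1, 0, 0, 0)" using g1(2) g2e by (simp add: g3_def hplus_def)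
    obtain z z2 z3 where c4: "g3 c4 = (z, z2, z3, 1)"
    proof -
      have "sp (1, 0, 0, 0) (g3 c4) = 1" using sp_G[OF g3, of "(1, 0, 0, 0)" c4] g3e asm by simp
      then show ?thesis using that by (cases "g3 c4") auto
    qed
    have e1: "y2 mod N + P * z3 - P' * z2 = 0"
      using sp_G[OF g3, of c2 c4] asm g3c2 c4 by (simp add: g3_def)
    have e3: "y4 mod N + p2 * z3 - q2 * z2 = 0"
      using sp_G[OF g3, of c3 c4] asm g3c3 c4 by (simp add: g3_def)
    have z2: "z2 = P * (y4 mod N) - p2 * (y2 mod N)"
    proof -
      have "z2 = z2 * (P * q2 - P' * p2)" using det by simp
      also have "\<dots> = P * (y4 mod N) - p2 * (y2 mod N) - P * (y4 mod N + p2 * z3 - q2 * z2) + p2 * (y2 mod N + P * z3 - P' * z2)"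
        by (simp add: algebra_simps)
      finally show ?thesis using e1 e3 by simp
    qed
    have z3: "z3 = P' * (y4 mod N) - q2 * (y2 mod N)"
    proof -
      have "z3 = z3 * (P * q2 - P' * p2)" using det by simp
      also have "\<dots> = P' * (y4 mod N) - q2 * (y2 mod N) - P' * (y4 mod N + p2 * z3 - q2 * z2) + q2 * (y2 mod N + P * z3 - P' * z2)"
        by (simp add: algebra_simps)
      finally show ?thesis using e1 e3 by simp
    qed
    have C1pos: "C1 \<ge> 0" using vb by linarith
    have modb: "\<bar>k mod N\<bar> \<le> N" for k using N pos_mod_bound[of N k] pos_mod_sign[of N k] by linarith
    have prod: "\<bar>i * (k mod N)\<bar> \<le> C1 * N" if "\<bar>i\<bar> \<le> C1" for i k
      unfolding abs_mult using that modb[of k] C1pos by (intro mult_mono) auto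
    have zb: "\<bar>z2\<bar> \<le> 2 * (C1 * N)" "\<bar>z3\<bar> \<le> 2 * (C1 * N)"
      unfolding z2 z3 using prod[OF PP(1), of y4] prod[OF PP(2), of y4] prod[OF pqb(1), of y2] prod[OF pqb(2), of y2]
      by linarith+
    have CN: "0 \<le> C1 * N" using C1pos N by simp
    let ?g4 = "hplus (N * 0) (N * 0) (N * - (z div N))"
    define g where "g = ?g4 \<circ> g3"
    have "g \<in> G" unfolding g_def by (intro comp_G hplus_G g3)
    moreover have "g (1, 0, 0, 0) = (1, 0, 0, 0)" using g3e by (simp add: g_def hplus_def)
    moreover have "g c2 = (y2 mod N, P, P', 0)" using g3c2 by (simp add: g_def g3_def hplus_def)
    moreover have "g c3 = (y4 mod N, p2, q2, 0)" using g3c3 by (simp add: g_def g3_def hplus_def)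
    moreover have "g c4 = (z mod N, z2, z3, 1)" using c4 by (simp add: g_def hplus_def minus_mult_div_eq_mod)
    ultimately show "\<exists>g\<in>G. g (1, 0, 0, 0) = (1, 0, 0, 0) \<and> entries_le C (g c2) \<and> entries_le C (g c3) \<and> entries_le C (g c4)"
      using modb[of y2] modb[of y4] modb[of z] zb PP pqb CN C1pos N
      by (intro bexI[of _ g]) (auto simp: entries_le_def C_def)
  qed
qed

theorem frames_bounded:
  "\<exists>C. \<forall>c1 c2 c3 c4. sp c1 c2 = 0 \<and> sp c1 c3 = 0 \<and> sp c1 c4 = 1 \<and>
     sp c2 c3 = 1 \<and> sp c2 c4 = 0 \<and> sp c3 c4 = 0 \<and>
     (\<exists>x1 x2 x3 x4. c1 = (1 + N\<^sup>2 * x1, N\<^sup>2 * x2, N\<^sup>2 * x3, N\<^sup>2 * x4)) \<longrightarrow>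
     (\<exists>g\<in>G. entries_le C (g c1) \<and> entries_le C (g c2) \<and> entries_le C (g c3) \<and> entries_le C (g c4))"
proof -
  obtain C where C: "\<forall>c2 c3 c4. sp (1, 0, 0, 0) c2 = 0 \<and> sp (1, 0, 0, 0) c3 = 0 \<and> sp (1, 0, 0, 0) c4 = 1 \<and>
     sp c2 c3 = 1 \<and> sp c2 c4 = 0 \<and> sp c3 c4 = 0 \<longrightarrow>
     (\<exists>g\<in>G. g (1, 0, 0, 0) = (1, 0, 0, 0) \<and> entries_le C (g c2) \<and> entries_le C (g c3) \<and> entries_le C (g c4))"
    using stabiliser_frames_bounded by blast
  show ?thesis
  proof (intro exI[of _ "max C 1"] allI impI, elim conjE exE)
    fix c1 c2 c3 c4 x1 x2 x3 x4
    assume asm: "sp c1 c2 = 0" "sp c1 c3 = 0" "sp c1 c4 = 1" "sp c2 c3 = 1" "sp c2 c4 = 0" "sp c3 c4 = 0"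
      and c1: "c1 = (1 + N\<^sup>2 * x1, N\<^sup>2 * x2, N\<^sup>2 * x3, N\<^sup>2 * x4)"
    obtain y1 y2 y3 y4 where c4: "c4 = (y1, y2, y3, y4)" by (cases c4) auto
    have "\<exists>g\<in>G. g c1 = (1, 0, 0, 0)"
      unfolding c1
      by (rule first_column_to_unit[where p = y4 and q = y3 and r = "- y2" and s = "- y1"])
         (use asm(3) in \<open>auto simp: c1 c4 power2_eq_square\<close>)
    then obtain g where g: "g \<in> G" "g c1 = (1, 0, 0, 0)" by blast
    have "sp (g a) (g b) = sp a b" for a b by (rule sp_G[OF g(1)])
    then obtain h where h: "h \<in> G" "h (1, 0, 0, 0) = (1, 0, 0, 0)"
      "entries_le C (h (g c2))" "entries_le C (h (g c3))" "entries_le C (h (g c4))"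
      using C asm g(2) by metis
    have mono: "entries_le C x \<Longrightarrow> entries_le (max C 1) x" for x
      by (cases x) (auto simp: entries_le_def)
    show "\<exists>g\<in>G. entries_le (max C 1) (g c1) \<and> entries_le (max C 1) (g c2) \<and> entries_le (max C 1) (g c3) \<and> entries_le (max C 1) (g c4)"
      using h g comp_G[OF h(1) g(1)] mono
      by (intro bexI[of _ "h \<circ> g"]) (auto simp: entries_le_def)
  qed
qed

end

section \<open>Transvections\<close>

declare split_paired_All [simp del] split_paired_Ex [simp del]

definition scale4 :: "int \<Rightarrow> z4 \<Rightarrow> z4" where
  "scale4 c = (\<lambda>(x1, x2, x3, x4). (c * x1, c * x2, c * x3, c * x4))"

lemma scale4_simp [simp]: "scale4 c (x1, x2, x3, x4) = (c * x1, c * x2, c * x3, c * x4)"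
  by (simp add: scale4_def)

definition linear4 :: "(z4 \<Rightarrow> z4) \<Rightarrow> bool" where
  "linear4 h \<longleftrightarrow> (\<forall>x y c. h (x + scale4 c y) = h x + scale4 c (h y))"

definition transv :: "int \<Rightarrow> z4 \<Rightarrow> z4 \<Rightarrow> z4" where
  "transv t y x = x + scale4 (t * sp x y) y"

lemma transv_simp [simp]:
  "transv t (y1, y2, y3, y4) (x1, x2, x3, x4) =
    (let s = t * (x1 * y4 - x4 * y1 + x2 * y3 - x3 * y2)
     in (x1 + s * y1, x2 + s * y2, x3 + s * y3, x4 + s * y4))"
  by (simp add: transv_def Let_def)

lemma sp_left: "sp (x + scale4 c y) z = sp x z + c * sp y z"
  by (cases x; cases y; cases z) (simp add: algebra_simps)

lemma sp_right: "sp z (x + scale4 c y) = sp z x + c * sp z y"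
  by (cases x; cases y; cases z) (simp add: algebra_simps)

lemma sp_self [simp]: "sp x x = 0"
  by (cases x) simp

lemma sp_swap: "sp y x = - sp x y"
  by (cases x; cases y) simp

lemma sp_scale: "sp (scale4 c x) y = c * sp x y" "sp x (scale4 c y) = c * sp x y"
  by (cases x; cases y; simp add: algebra_simps)+

lemma scale4_add: "scale4 c (x + scale4 b y) = scale4 c x + scale4 (c * b) y"
  by (cases x; cases y) (simp add: algebra_simps)

lemma zero_z4: "(0 :: z4) = (0, 0, 0, 0)"
  by (simp add: zero_prod_def)

lemma linear4_add: "linear4 h \<Longrightarrow> h (x + y) = h x + h y"
proof -
  have "scale4 1 y = y" for y by (cases y) simp
  then show "linear4 h \<Longrightarrow> h (x + y) = h x + h y" unfolding linear4_def by metis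
qed

lemma linear4_scale: "linear4 h \<Longrightarrow> h (scale4 c x) = scale4 c (h x)"
proof -
  assume h: "linear4 h"
  have "h 0 = h 0 + h 0" using linear4_add[OF h, of 0 0] by simp
  then have "h 0 = 0" by simp
  then show ?thesis using h unfolding linear4_def by (metis add_0)
qed

lemma linear4_comp: "linear4 g \<Longrightarrow> linear4 h \<Longrightarrow> linear4 (g \<circ> h)"
  by (simp add: linear4_def)

lemma linear4_transv: "linear4 (transv t y)"
  unfolding linear4_def
proof (intro allI)
  fix x z c
  have "scale4 (t * sp (x + scale4 c z) y) y = scale4 (t * sp x y) y + scale4 c (scale4 (t * sp z y) y)"
    unfolding sp_left by (cases y) (simp add: algebra_simps)
  moreover have "scale4 c (z + scale4 (t * sp z y) y) = scale4 c z + scale4 c (scale4 (t * sp z y) y)"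
    by (cases z; cases y) (simp add: algebra_simps)
  ultimately show "transv t y (x + scale4 c z) = transv t y x + scale4 c (transv t y z)"
    by (simp add: transv_def algebra_simps)
qed

lemma sp_transv: "sp (transv t y x) (transv t y z) = sp x z"
  unfolding transv_def sp_left sp_right by (simp add: sp_swap[of y z] algebra_simps)

lemma transv_inverse: "transv (- t) y (transv t y x) = x"
proof -
  have "transv (- t) y (transv t y x) = x + (scale4 (t * sp x y) y + scale4 (- t * sp x y) y)"
    by (simp add: transv_def sp_left add.assoc)
  also have "scale4 (t * sp x y) y + scale4 (- t * sp x y) y = 0"
    by (cases y) (simp add: zero_z4)
  finally show ?thesis by simp
qed

lemma transv_conj:
  assumes "linear4 h" and "\<And>x. h (h' x) = x" and "\<And>x y. sp (h x) (h y) = sp x y"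
  shows "transv t (h y) = h \<circ> (transv t y \<circ> h')"
proof
  fix x
  have "(h \<circ> (transv t y \<circ> h')) x = h (h' x) + scale4 (t * sp (h' x) y) (h y)"
    using assms(1) by (simp add: transv_def linear4_def)
  also have "sp (h' x) y = sp x (h y)" using assms(3)[of "h' x" y] by (simp add: assms(2))
  finally show "transv t (h y) x = (h \<circ> (transv t y \<circ> h')) x" by (simp add: transv_def assms(2))
qed

section \<open>The family of hypergeometric groups\<close>

text \<open>
  The images of \<open>A\<close> and of its inverse in coordinates in which the invariant form is \<open>sp\<close>.
\<close>

definition shift :: "int \<Rightarrow> int \<Rightarrow> z4 \<Rightarrow> z4" where
  "shift d k = (\<lambda>(x1, x2, x3, x4). (x1 + x2 + k * x4, x2 - d * x3 + d * x4, x3 - x4, x4))"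

definition shift_inv :: "int \<Rightarrow> int \<Rightarrow> z4 \<Rightarrow> z4" where
  "shift_inv d k = (\<lambda>(x1, x2, x3, x4). (x1 - x2 - d * x3 - k * x4, x2 + d * x3, x3 + x4, x4))"

lemma shift_inverse: "shift d k (shift_inv d k x) = x" "shift_inv d k (shift d k x) = x"
  by (cases x; simp add: shift_def shift_inv_def algebra_simps)+

lemma linear4_shift: "linear4 (shift d k)" "linear4 (shift_inv d k)"
  unfolding linear4_def by (auto simp: shift_def shift_inv_def algebra_simps split_paired_All)

lemma sp_shift: "sp (shift d k x) (shift d k y) = sp x y"
  by (cases x; cases y) (simp add: shift_def algebra_simps)

lemma sp_shift_inv: "sp (shift_inv d k x) (shift_inv d k y) = sp x y"
  using sp_shift[of d k "shift_inv d k x" "shift_inv d k y"] by (simp add: shift_inverse)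

text \<open>
  A straight-line program: each step appends one vector to the list, namely the image of an earlier entry
  under \<open>shift\<close>, under its inverse, or under the transvection along another earlier entry.
\<close>

datatype step = Fwd nat | Bwd nat | Add nat nat | Sub nat nat

text \<open>Totalised by the vector \<open>e\<close>, so that every program produces vectors with transvections in the group.\<close>

definition entry :: "z4 list \<Rightarrow> nat \<Rightarrow> z4" where
  "entry ys i = (if i < length ys then ys ! i else (0, 0, 0, 1))"

fun next_vector :: "int \<Rightarrow> int \<Rightarrow> z4 list \<Rightarrow> step \<Rightarrow> z4" where
  "next_vector d k ys (Fwd i) = shift d k (entry ys i)"
| "next_vector d k ys (Bwd i) = shift_inv d k (entry ys i)"
| "next_vector d k ys (Add i j) = transv 1 (entry ys j) (entry ys i)"
| "next_vector d k ys (Sub i j) = transv (- 1) (entry ys j) (entry ys i)"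

fun run :: "int \<Rightarrow> int \<Rightarrow> z4 list \<Rightarrow> step list \<Rightarrow> z4 list" where
  "run d k ys [] = ys"
| "run d k ys (s # ss) = run d k (ys @ [next_vector d k ys s]) ss"

text \<open>
  If \<open>q\<close> is a frame with \<open>sp (q\<^sub>i) (q\<^sub>j)\<close> equal to \<open>\<mu>\<close> times the standard Gram matrix, these are \<open>\<mu>\<close>
  times the coordinates with respect to \<open>q\<close>. The factor avoids denominators.
\<close>

definition coords :: "z4 \<times> z4 \<times> z4 \<times> z4 \<Rightarrow> z4 \<Rightarrow> z4" where
  "coords = (\<lambda>(q1, q2, q3, q4) z. (sp z q4, sp z q3, - sp z q2, - sp z q1))"

lemma linear4_coords: "linear4 (coords q)"
  unfolding linear4_def
  by (cases q) (auto simp: coords_def sp_left algebra_simps split_paired_All)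

text \<open>
  Monoids of maps instead of groups: every generator comes with its inverse. The set \<open>H\<close> will
  consist of the maps that some element of \<open>\<Gamma>\<close> induces on a sublattice of finite index.
\<close>

locale hypergeometric_monoid =
  fixes d k :: int and H :: "(z4 \<Rightarrow> z4) set"
  assumes id_H: "id \<in> H" and comp_H: "g \<in> H \<Longrightarrow> h \<in> H \<Longrightarrow> g \<circ> h \<in> H"
    and shift_H: "shift d k \<in> H" "shift_inv d k \<in> H"
    and refl_H: "transv 1 (0, 0, 0, 1) \<in> H" "transv (- 1) (0, 0, 0, 1) \<in> H"
begin

definition transv_vectors :: "z4 set" where
  "transv_vectors = {y. transv 1 y \<in> H \<and> transv (- 1) y \<in> H}"

lemma transv_vectors_start: "(0, 0, 0, 1) \<in> transv_vectors"
  using refl_H by (simp add: transv_vectors_def)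

lemma transv_vectors_shift: "y \<in> transv_vectors \<Longrightarrow> shift d k y \<in> transv_vectors"
  unfolding transv_vectors_def
  by (simp add: transv_conj[of "shift d k" "shift_inv d k"] linear4_shift shift_inverse sp_shift
      comp_H shift_H)

lemma transv_vectors_shift_inv: "y \<in> transv_vectors \<Longrightarrow> shift_inv d k y \<in> transv_vectors"
  unfolding transv_vectors_def
  by (simp add: transv_conj[of "shift_inv d k" "shift d k"] linear4_shift shift_inverse sp_shift_inv
      comp_H shift_H)

text \<open>A conjugate \<open>h t h\<^sup>-\<^sup>1\<close> of the transvection \<open>t\<close> along \<open>x\<close> is the transvection along \<open>h x\<close>.\<close>

lemma transv_vectors_transv:
  "x \<in> transv_vectors \<Longrightarrow> y \<in> transv_vectors \<Longrightarrow>
    transv 1 y x \<in> transv_vectors \<and> transv (- 1) y x \<in> transv_vectors"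
proof -
  assume x: "x \<in> transv_vectors" and y: "y \<in> transv_vectors"
  have *: "transv 1 y (transv (- 1) y z) = z" for z using transv_inverse[of "- 1" y z] by simp
  show ?thesis using x y
    unfolding transv_vectors_def
    by (simp add: transv_conj[of "transv 1 y" "transv (- 1) y"] transv_conj[of "transv (- 1) y" "transv 1 y"]
      linear4_transv transv_inverse * sp_transv comp_H)
qed

lemma transv_vectors_run: "set ys \<subseteq> transv_vectors \<Longrightarrow> set (run d k ys ss) \<subseteq> transv_vectors"
proof (induction ss arbitrary: ys)
  case (Cons s ss)
  have e: "entry ys i \<in> transv_vectors" for i
    using Cons.prems transv_vectors_start by (auto simp: entry_def)
  have "next_vector d k ys s \<in> transv_vectors"
    using transv_vectors_shift transv_vectors_shift_inv transv_vectors_transv e by (cases s) auto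
  then show ?case using Cons by simp
qed simp

text \<open>
  The elements of \<open>H\<close> that have integral matrices in the frame \<open>q\<close>, written in that frame. In general not
  all of \<open>H\<close> qualifies, but enough of it does.
\<close>

definition adapted :: "z4 \<times> z4 \<times> z4 \<times> z4 \<Rightarrow> (z4 \<Rightarrow> z4) set" where
  "adapted q = {g. linear4 g \<and> (\<forall>x y. sp (g x) (g y) = sp x y) \<and>
     (\<exists>h\<in>H. \<forall>x. coords q (h x) = g (coords q x))}"

lemma adapted_id: "id \<in> adapted q"
  using id_H by (auto simp: adapted_def linear4_def intro!: bexI[of _ id])

lemma adapted_comp: "g \<in> adapted q \<Longrightarrow> h \<in> adapted q \<Longrightarrow> g \<circ> h \<in> adapted q"
proof -
  assume g: "g \<in> adapted q" and h: "h \<in> adapted q"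
  obtain g' where g': "g' \<in> H" "\<And>x. coords q (g' x) = g (coords q x)" using g by (auto simp: adapted_def)
  obtain h' where h': "h' \<in> H" "\<And>x. coords q (h' x) = h (coords q x)" using h by (auto simp: adapted_def)
  have "\<exists>f\<in>H. \<forall>x. coords q (f x) = (g \<circ> h) (coords q x)"
    using g' h' comp_H[OF g'(1) h'(1)] by (intro bexI[of _ "g' \<circ> h'"]) auto
  then show ?thesis using g h linear4_comp[of g h] by (simp add: adapted_def)
qed

text \<open>
  A vector \<open>y\<close> has integral coordinates \<open>w\<close> in the frame \<open>q\<close> iff \<open>coords q y\<close> is \<open>\<mu>\<close> times \<open>w\<close>. As the frame
  scales the form by \<open>\<mu>\<close>, the transvection along \<open>y\<close> becomes one along \<open>w\<close> with parameter \<open>\<mu>\<close>.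
\<close>

lemma adapted_transv:
  assumes q: "\<And>x y. sp (coords q x) (coords q y) = \<mu> * sp x y" and "\<mu> \<noteq> 0"
    and y: "y \<in> transv_vectors" and w: "coords q y = scale4 \<mu> w" and e: "e = 1 \<or> e = (- 1)"
  shows "transv (e * \<mu>) w \<in> adapted q"
proof -
  have h: "transv e y \<in> H" using y e by (auto simp: transv_vectors_def)
  have "coords q (transv e y x) = transv (e * \<mu>) w (coords q x)" for x
  proof -
    have "\<mu> * sp (coords q x) w = \<mu> * sp x y" using q[of x y] by (simp add: w sp_scale)
    then have s: "sp (coords q x) w = sp x y" using \<open>\<mu> \<noteq> 0\<close> by simp
    have "coords q (transv e y x) = coords q x + scale4 (e * sp x y) (scale4 \<mu> w)"
      unfolding transv_def w[symmetric] using linear4_coords by (simp add: linear4_def)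
    also have "scale4 (e * sp x y) (scale4 \<mu> w) = scale4 (e * \<mu> * sp (coords q x) w) w"
      unfolding s by (cases w) (simp add: mult_ac)
    finally show ?thesis by (simp add: transv_def)
  qed
  then have "\<exists>h\<in>H. \<forall>x. coords q (h x) = transv (e * \<mu>) w (coords q x)" using h by blast
  then show ?thesis unfolding adapted_def using linear4_transv sp_transv by blast
qed

end

section \<open>Heisenberg groups from pairs of transvections\<close>

text \<open>
  The two vectors are orthogonal and differ by a multiple of a vector that is orthogonal to both; the
  quotient of their transvections is trivial on the rank 2 quotient.
\<close>

lemma hplus_transv:
  "transv t (y + c, a, b, 0) \<circ> transv (- t) (y, a, b, 0) = hplus (- (t * c * a)) (- (t * c * b)) (- (t * c * (2 * y + c)))"
  by (auto simp: hplus_def fun_eq_iff Let_def algebra_simps)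

lemma hminus_transv:
  "transv t (0, a, b, y + c) \<circ> transv (- t) (0, a, b, y) = hminus (t * c * a) (t * c * b) (t * c * (2 * y + c))"
  by (auto simp: hminus_def fun_eq_iff Let_def algebra_simps)

lemma hplus_comp: "hplus a b z \<circ> hplus a' b' z' = hplus (a + a') (b + b') (z + z' + (a * b' - a' * b))"
  by (auto simp: hplus_def fun_eq_iff algebra_simps)

lemma hminus_comp: "hminus a b z \<circ> hminus a' b' z' = hminus (a + a') (b + b') (z + z' + (a' * b - a * b'))"
  by (auto simp: hminus_def fun_eq_iff algebra_simps)

text \<open>
  Two elements whose horizontal parts are independent, with determinant \<open>D\<close>, have a commutator in the centre
  with entry \<open>\<plusminus> 2 D\<close>. Modulo that, products of powers of the two elements reach every horizontal part
  in \<open>D \<int>\<^sup>2\<close>; restricting to exponents divisible by \<open>2 D\<close> makes the central error a multiple of \<open>2 D\<close>,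
  so that the centre can correct it. This is where \<open>2 D\<^sup>2\<close> comes from. The sign \<open>s\<close> covers both
  Heisenberg groups.
\<close>

lemma heisenberg_lattice:
  fixes F :: "int \<Rightarrow> int \<Rightarrow> int \<Rightarrow> z4 \<Rightarrow> z4"
  assumes id: "id \<in> G" "F 0 0 0 = id" and comp: "\<And>g h. g \<in> G \<Longrightarrow> h \<in> G \<Longrightarrow> g \<circ> h \<in> G"
    and F: "\<And>a b z a' b' z'. F a b z \<circ> F a' b' z' = F (a + a') (b + b') (z + z' + s * (a * b' - a' * b))"
    and s: "s = 1 \<or> s = - 1"
    and G: "F a b z \<in> G" "F (- a) (- b) (- z) \<in> G" "F a' b' z' \<in> G" "F (- a') (- b') (- z') \<in> G"
    and N: "2 * (a * b' - a' * b)\<^sup>2 dvd N"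
  shows "F (N * p) (N * q) (N * r) \<in> G"
proof -
  define D where "D = a * b' - a' * b"
  have pow: "F (n * a) (n * b) (n * z) \<in> G" if "F a b z \<in> G" "F (- a) (- b) (- z) \<in> G" for a b z n
  proof -
    have pos: "F (int i * a) (int i * b) (int i * z) \<in> G" if "F a b z \<in> G" for a b z and i
    proof (induction i)
      case (Suc i)
      have "F a b z \<circ> F (int i * a) (int i * b) (int i * z) \<in> G" using that Suc comp by blast
      then show ?case unfolding F by (simp add: algebra_simps)
    qed (use id in \<open>simp add: id_def\<close>)
    show ?thesis
    proof (cases "n \<ge> 0")
      case True then show ?thesis using pos[OF that(1), of "nat n"] by simp
    next
      case False then show ?thesis using pos[OF that(2), of "nat (- n)"] by simp
    qed
  qed
  have "(F a b z \<circ> F a' b' z') \<circ> (F (- a) (- b) (- z) \<circ> F (- a') (- b') (- z')) \<in> G"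
    using G comp by blast
  then have c1: "F 0 0 (2 * s * D) \<in> G"
    unfolding F by (simp add: D_def algebra_simps)
  have "(F (- a) (- b) (- z) \<circ> F a' b' z') \<circ> (F a b z \<circ> F (- a') (- b') (- z')) \<in> G"
    using G comp by blast
  then have c2: "F 0 0 (- (2 * s * D)) \<in> G"
    unfolding F by (simp add: D_def algebra_simps)
  have centre: "F 0 0 (2 * s * D * n) \<in> G" for n
    using pow[of 0 0 "2 * s * D" n] c1 c2 by (simp add: mult.commute)
  obtain M where M: "N = 2 * D\<^sup>2 * M" using N by (auto simp: D_def elim!: dvdE)
  define u where "u = M * (p * b' - q * a')"
  define v where "v = M * (q * a - p * b)"
  define i where "i = 2 * D * u"
  define j where "j = 2 * D * v"
  define l where "l = i * z + j * z' + s * (i * j * D)"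
  have s2: "s * s = 1" using s by auto
  define K where "K = D * M * r - (u * z + v * z' + s * (u * j * D))"
  have "l = 2 * D * (u * z + v * z' + s * (u * j * D))"
    unfolding l_def i_def distrib_left by (simp only: mult_ac add_ac j_def)
  moreover have "N * r = 2 * D * (D * M * r)"
    by (simp only: M power2_eq_square mult_ac)
  ultimately have "N * r - l = 2 * D * K"
    unfolding K_def right_diff_distrib by simp
  also have "\<dots> = (s * s) * (2 * D * K)" unfolding s2 by simp
  also have "\<dots> = 2 * s * D * (s * K)" by (simp only: mult_ac)
  finally have "\<exists>n. N * r - l = 2 * s * D * n" by blast
  then obtain n where n: "N * r - l = 2 * s * D * n" ..
  have "F 0 0 (2 * s * D * n) \<circ> (F (i * a) (i * b) (i * z) \<circ> F (j * a') (j * b') (j * z')) \<in> G"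
    by (intro comp centre pow G)
  moreover have "i * a + j * a' = N * p" "i * b + j * b' = N * q"
  proof -
    have "u * a + v * a' = M * p * D" "u * b + v * b' = M * q * D"
      by (simp_all add: u_def v_def D_def algebra_simps)
    moreover have "i * a + j * a' = 2 * D * (u * a + v * a')" "i * b + j * b' = 2 * D * (u * b + v * b')"
      by (simp_all add: i_def j_def algebra_simps)
    ultimately show "i * a + j * a' = N * p" "i * b + j * b' = N * q"
      by (simp_all add: M power2_eq_square)
  qed
  moreover have "2 * s * D * n + (i * z + j * z' + s * (i * a * (j * b') - j * a' * (i * b))) = N * r"
  proof -
    have "i * a * (j * b') - j * a' * (i * b) = i * j * D" by (simp add: D_def algebra_simps)
    then show ?thesis using n by (simp add: l_def)
  qed
  ultimately show ?thesis unfolding F by simp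
qed

lemma lifts_transv: "lifts t (a, b) (transv t (y, a, b, 0))"
proof -
  have "transv t (y, a, b, 0) (x1, x2, x3, 0) = (x1 + t * (x2 * b - x3 * a) * y,
      (1 + t * a * b) * x2 + - (t * a * a) * x3, t * b * b * x2 + (1 - t * a * b) * x3, 0)" for x1 x2 x3
    by (simp add: Let_def algebra_simps)
  then show ?thesis unfolding acts_on_quotient_def transv_matrix_def by auto
qed

section \<open>Certificates\<close>

text \<open>
  Executable test that, up to sign, all vectors of \<open>ws\<close> occur among the coordinates of the vectors produced
  by the program. A vector and its negative have the same transvection.
\<close>

definition certified :: "int \<Rightarrow> int \<Rightarrow> int \<Rightarrow> z4 \<times> z4 \<times> z4 \<times> z4 \<Rightarrow> step list \<Rightarrow> z4 list \<Rightarrow> bool" where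
  "certified d k \<mu> q steps ws \<longleftrightarrow>
     (let cs = map (coords q) (run d k [(0, 0, 0, 1)] steps)
      in list_all (\<lambda>w. scale4 \<mu> w \<in> set cs \<or> scale4 (- \<mu>) w \<in> set cs) ws)"

lemma transv_uminus: "transv t (scale4 (- 1) y) = transv t y"
  by (cases y) (auto simp: fun_eq_iff Let_def algebra_simps)

context hypergeometric_monoid
begin

definition transv_coords :: "int \<Rightarrow> z4 \<times> z4 \<times> z4 \<times> z4 \<Rightarrow> z4 set" where
  "transv_coords \<mu> q = {w. transv \<mu> w \<in> adapted q \<and> transv (- \<mu>) w \<in> adapted q}"

lemma certified_transv_coords:
  assumes q: "\<And>x y. sp (coords q x) (coords q y) = \<mu> * sp x y" and "\<mu> \<noteq> 0"
    and c: "certified d k \<mu> q steps ws"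
  shows "set ws \<subseteq> transv_coords \<mu> q"
proof
  fix w assume w: "w \<in> set ws"
  have orb: "y \<in> transv_vectors" if "y \<in> set (run d k [(0, 0, 0, 1)] steps)" for y
    using transv_vectors_run[of "[(0, 0, 0, 1)]"] transv_vectors_start that by auto
  obtain y e where y: "y \<in> transv_vectors" and e: "e = 1 \<or> e = - 1" "coords q y = scale4 (e * \<mu>) w"
    using c w orb unfolding certified_def Let_def list_all_iff
    by (metis (no_types, lifting) image_iff list.set_map mult_1 mult_minus1)
  have "scale4 (e * \<mu>) w = scale4 \<mu> (scale4 e w)" by (cases w) simp
  then have *: "transv (f * \<mu>) (scale4 e w) \<in> adapted q" if "f = 1 \<or> f = - 1" for f
    using adapted_transv[OF q \<open>\<mu> \<noteq> 0\<close> y] e that by auto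
  have "transv t (scale4 e w) = transv t w" for t
    using e(1) transv_uminus[of t w] by (cases w) auto
  then show "w \<in> transv_coords \<mu> q"
    using *[of 1] *[of "- 1"] by (simp add: transv_coords_def)
qed

definition realised :: "z4 \<times> z4 \<times> z4 \<times> z4 \<Rightarrow> z4 \<Rightarrow> bool" where
  "realised q M \<longleftrightarrow> (\<exists>g\<in>adapted q. acts_on_quotient M g)"

text \<open>Both signs are recorded, as the inverse of a transvection is needed as well.\<close>

definition liftable :: "int \<Rightarrow> z4 \<times> z4 \<times> z4 \<times> z4 \<Rightarrow> int \<times> int \<Rightarrow> bool" where
  "liftable \<mu> q v \<longleftrightarrow> realised q (transv_matrix \<mu> v) \<and> realised q (transv_matrix (- \<mu>) v)"

lemma realised_mult: "realised q M \<Longrightarrow> realised q M' \<Longrightarrow> realised q (matrix2_mult M M')"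
  unfolding realised_def using adapted_comp acts_on_quotient_comp by blast

lemma liftable_transv_coords: "(y, a, b, 0) \<in> transv_coords \<mu> q \<Longrightarrow> liftable \<mu> q (a, b)"
  unfolding liftable_def realised_def transv_coords_def using lifts_transv by blast

text \<open>
  What a certificate has to provide: two pairs of vectors for each Heisenberg group, and the
  directions \<open>V\<close>.
\<close>

theorem reducing_adapted:
  assumes q: "\<And>x y. sp (coords q x) (coords q y) = \<mu> * sp x y" and mu: "\<mu> > 0"
    and plus: "(y1, a1, b1, 0) \<in> transv_coords \<mu> q" "(y1', a1, b1, 0) \<in> transv_coords \<mu> q" "y1 \<noteq> y1'"
      "(y2, a2, b2, 0) \<in> transv_coords \<mu> q" "(y2', a2, b2, 0) \<in> transv_coords \<mu> q" "y2 \<noteq> y2'" "a1 * b2 \<noteq> a2 * b1"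
    and minus: "(0, a3, b3, y3) \<in> transv_coords \<mu> q" "(0, a3, b3, y3') \<in> transv_coords \<mu> q" "y3 \<noteq> y3'"
      "(0, a4, b4, y4) \<in> transv_coords \<mu> q" "(0, a4, b4, y4') \<in> transv_coords \<mu> q" "y4 \<noteq> y4'" "a3 * b4 \<noteq> a4 * b3"
    and V: "finite V" "\<And>v1 v2. (v1, v2) \<in> V \<Longrightarrow> coprime v1 v2"
      "\<And>v. v \<in> V \<Longrightarrow> liftable \<mu> q v"
      "\<And>p q. \<exists>(v1, v2)\<in>V. p * v2 - q * v1 = 0 \<or>
        \<mu> * \<bar>p * v2 - q * v1\<bar> * (v1\<^sup>2 + v2\<^sup>2) < 2 * \<bar>p * v1 + q * v2\<bar>"
  shows "\<exists>N. reducing_monoid (adapted q) N \<mu> V"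
proof -
  have hp: "hplus (- (t * (y' - y) * a)) (- (t * (y' - y) * b)) (- (t * (y' - y) * (y + y'))) \<in> adapted q"
    if "(y, a, b, 0) \<in> transv_coords \<mu> q" "(y', a, b, 0) \<in> transv_coords \<mu> q" "t = \<mu> \<or> t = - \<mu>" for y y' a b t
  proof -
    have "transv t (y + (y' - y), a, b, 0) \<circ> transv (- t) (y, a, b, 0) \<in> adapted q"
      using that by (intro adapted_comp) (auto simp: transv_coords_def)
    then show ?thesis unfolding hplus_transv by (simp add: algebra_simps)
  qed
  have hm: "hminus (t * (y' - y) * a) (t * (y' - y) * b) (t * (y' - y) * (y + y')) \<in> adapted q"
    if "(0, a, b, y) \<in> transv_coords \<mu> q" "(0, a, b, y') \<in> transv_coords \<mu> q" "t = \<mu> \<or> t = - \<mu>" for y y' a b t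
  proof -
    have "transv t (0, a, b, y + (y' - y)) \<circ> transv (- t) (0, a, b, y) \<in> adapted q"
      using that by (intro adapted_comp) (auto simp: transv_coords_def)
    then show ?thesis unfolding hminus_transv by (simp add: algebra_simps)
  qed
  define c1 c2 c3 c4 where "c1 = - (\<mu> * (y1' - y1))" and "c2 = - (\<mu> * (y2' - y2))"
    and "c3 = \<mu> * (y3' - y3)" and "c4 = \<mu> * (y4' - y4)"
  define D where "D = c1 * a1 * (c2 * b2) - c2 * a2 * (c1 * b1)"
  define D' where "D' = c3 * a3 * (c4 * b4) - c4 * a4 * (c3 * b3)"
  have "D = c1 * c2 * (a1 * b2 - a2 * b1)" "D' = c3 * c4 * (a3 * b4 - a4 * b3)"
    by (simp_all add: D_def D'_def algebra_simps)
  moreover have "c1 \<noteq> 0" "c2 \<noteq> 0" "c3 \<noteq> 0" "c4 \<noteq> 0"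
    using mu plus(3,6) minus(3,6) by (simp_all add: c1_def c2_def c3_def c4_def)
  ultimately have D: "D \<noteq> 0" "D' \<noteq> 0" using plus(7) minus(7) by simp_all
  define N where "N = 2 * D\<^sup>2 * (2 * D'\<^sup>2)"
  have N: "2 * D\<^sup>2 dvd N" "2 * D'\<^sup>2 dvd N" by (simp_all add: N_def)
  have "N \<ge> 2"
  proof -
    have "D\<^sup>2 \<ge> 1" "D'\<^sup>2 \<ge> 1" using D by (simp_all add: int_one_le_iff_zero_less)
    then have "2 * 1 * (2 * 1) \<le> N" unfolding N_def by (intro mult_mono) auto
    then show ?thesis by simp
  qed
  have hplus_id: "hplus 0 0 0 = id" and hminus_id: "hminus 0 0 0 = id"
    by (auto simp: hplus_def hminus_def)
  have hplus_N: "hplus (N * a) (N * b) (N * c) \<in> adapted q" for a b c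
    by (rule heisenberg_lattice[where G = "adapted q" and F = hplus and s = 1
        and a = "c1 * a1" and b = "c1 * b1" and a' = "c2 * a2" and b' = "c2 * b2"
        and z = "c1 * (y1 + y1')" and z' = "c2 * (y2 + y2')", OF adapted_id hplus_id adapted_comp])
      (use hp[OF plus(1,2), of \<mu>] hp[OF plus(1,2), of "- \<mu>"] hp[OF plus(4,5), of \<mu>] hp[OF plus(4,5), of "- \<mu>"] N(1)
        in \<open>simp_all add: hplus_comp c1_def c2_def D_def\<close>)
  have hminus_N: "hminus (N * a) (N * b) (N * c) \<in> adapted q" for a b c
    by (rule heisenberg_lattice[where G = "adapted q" and F = hminus and s = "- 1"
        and a = "c3 * a3" and b = "c3 * b3" and a' = "c4 * a4" and b' = "c4 * b4"
        and z = "c3 * (y3 + y3')" and z' = "c4 * (y4 + y4')", OF adapted_id hminus_id adapted_comp])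
      (use hm[OF minus(1,2), of \<mu>] hm[OF minus(1,2), of "- \<mu>"] hm[OF minus(4,5), of \<mu>] hm[OF minus(4,5), of "- \<mu>"] N(2)
        in \<open>simp_all add: hminus_comp c3_def c4_def D'_def\<close>)
  have "sp (g x) (g y) = sp x y" if "g \<in> adapted q" for g x y
    using that by (simp add: adapted_def)
  moreover have "\<exists>g\<in>adapted q. lifts \<mu> v g" "\<exists>g\<in>adapted q. lifts (- \<mu>) v g" if "v \<in> V" for v
    using V(3)[OF that] by (simp_all add: liftable_def realised_def)
  ultimately have "reducing_monoid (adapted q) N \<mu> V"
    by (intro reducing_monoid.intro adapted_id adapted_comp \<open>N \<ge> 2\<close> mu hplus_N hminus_N V)
  then show ?thesis ..
qed

end

section \<open>The four parameter pairs\<close>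

context hypergeometric_monoid
begin

definition has_reducing_frame :: bool where
  "has_reducing_frame \<longleftrightarrow> (\<exists>q1 q2 q3 q4 \<mu> N V. \<mu> > 0 \<and>
     (\<forall>x y. sp (coords (q1, q2, q3, q4) x) (coords (q1, q2, q3, q4) y) = \<mu> * sp x y) \<and>
     coords (q1, q2, q3, q4) q1 = (\<mu>, 0, 0, 0) \<and> coords (q1, q2, q3, q4) q2 = (0, \<mu>, 0, 0) \<and>
     coords (q1, q2, q3, q4) q3 = (0, 0, \<mu>, 0) \<and> coords (q1, q2, q3, q4) q4 = (0, 0, 0, \<mu>) \<and>
     reducing_monoid (adapted (q1, q2, q3, q4)) N \<mu> V)"

lemma has_reducing_frameI:
  assumes "\<mu> > 0" and "\<And>x y. sp (coords (q1, q2, q3, q4) x) (coords (q1, q2, q3, q4) y) = \<mu> * sp x y"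
    and "coords (q1, q2, q3, q4) q1 = (\<mu>, 0, 0, 0)" and "coords (q1, q2, q3, q4) q2 = (0, \<mu>, 0, 0)"
    and "coords (q1, q2, q3, q4) q3 = (0, 0, \<mu>, 0)" and "coords (q1, q2, q3, q4) q4 = (0, 0, 0, \<mu>)"
    and "\<exists>N. reducing_monoid (adapted (q1, q2, q3, q4)) N \<mu> V"
  shows has_reducing_frame
  unfolding has_reducing_frame_def using assms by blast

text \<open>
  The transvections with parameter 3 along \<open>(1, 0), (0, 1), (1, 1), (1, -1)\<close> are parabolic elements of the
  principal congruence subgroup of level 3, one for each of its four cusps, and their product in a suitable
  order is the identity. So three of them generate the fourth.
\<close>

lemma liftable_3:
  assumes "liftable 3 q (1, 0)" "liftable 3 q (0, 1)" "liftable 3 q (1, 1)"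
  shows "liftable 3 q (1, - 1)"
proof -
  have "transv_matrix 3 (1, - 1) = matrix2_mult (transv_matrix (- 3) (0, 1)) (matrix2_mult (transv_matrix (- 3) (1, 1)) (transv_matrix (- 3) (1, 0)))"
    "transv_matrix (- 3) (1, - 1) = matrix2_mult (transv_matrix 3 (1, 0)) (matrix2_mult (transv_matrix 3 (1, 1)) (transv_matrix 3 (0, 1)))"
    by (simp_all add: transv_matrix_def matrix2_mult_def)
  then show ?thesis using assms by (simp add: liftable_def realised_mult)
qed

text \<open>
  The same relation for level 4, which has six cusps. The directions \<open>(2, 1)\<close> and \<open>(2, -1)\<close> belong to the
  same cusp and are obtained from the other five.
\<close>

lemma liftable_4:
  assumes "liftable 4 q (1, 0)" "liftable 4 q (0, 1)" "liftable 4 q (1, 1)" "liftable 4 q (1, - 1)"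
    "liftable 4 q (1, 2)" "liftable 4 q (1, - 2)"
  shows "liftable 4 q (2, 1)" "liftable 4 q (2, - 1)"
proof -
  have "transv_matrix 4 (2, 1) = matrix2_mult (transv_matrix (- 4) (1, 0)) (matrix2_mult (transv_matrix (- 4) (1, - 1))
      (matrix2_mult (transv_matrix (- 4) (1, - 2)) (matrix2_mult (transv_matrix (- 4) (0, 1)) (transv_matrix (- 4) (1, 1)))))"
    "transv_matrix (- 4) (2, 1) = matrix2_mult (transv_matrix 4 (1, 1)) (matrix2_mult (transv_matrix 4 (1, 2))
      (matrix2_mult (transv_matrix 4 (0, 1)) (matrix2_mult (transv_matrix 4 (1, - 1)) (transv_matrix 4 (1, 0)))))"
    by (simp_all add: transv_matrix_def matrix2_mult_def)
  then show "liftable 4 q (2, 1)" using assms by (simp add: liftable_def realised_mult)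
  have "transv_matrix 4 (2, - 1) = matrix2_mult (transv_matrix (- 4) (1, - 1)) (matrix2_mult (transv_matrix (- 4) (1, - 2))
      (matrix2_mult (transv_matrix (- 4) (0, 1)) (matrix2_mult (transv_matrix (- 4) (1, 1)) (transv_matrix (- 4) (1, 0)))))"
    "transv_matrix (- 4) (2, - 1) = matrix2_mult (transv_matrix 4 (1, 0)) (matrix2_mult (transv_matrix 4 (1, 1))
      (matrix2_mult (transv_matrix 4 (1, 2)) (matrix2_mult (transv_matrix 4 (0, 1)) (transv_matrix 4 (1, - 1)))))"
    by (simp_all add: transv_matrix_def matrix2_mult_def)
  then show "liftable 4 q (2, - 1)" using assms by (simp add: liftable_def realised_mult)
qed

end

text \<open>
  The angles at which the transvection along \<open>v\<close> shortens a vector form a sector around the line through \<open>v\<close>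
  with half-angle \<open>arctan (2 / (m \<bar>v\<bar>\<^sup>2))\<close>. The sectors of the directions listed here cover the plane for
  \<open>m\<close> equal to 1, 3 and 4 respectively.
\<close>

abbreviation directions_1 :: "(int \<times> int) set" where
  "directions_1 \<equiv> {(1, 0), (0, 1)}"

abbreviation directions_3 :: "(int \<times> int) set" where
  "directions_3 \<equiv> {(1, 0), (0, 1), (1, 1), (1, - 1)}"

abbreviation directions_4 :: "(int \<times> int) set" where
  "directions_4 \<equiv> {(1, 0), (0, 1), (1, 1), (1, - 1), (1, 2), (1, - 2), (2, 1), (2, - 1)}"

lemma coprime_directions:
  "(v1, v2) \<in> directions_1 \<Longrightarrow> coprime v1 v2"
  "(v1, v2) \<in> directions_3 \<Longrightarrow> coprime v1 v2"
  "(v1, v2) \<in> directions_4 \<Longrightarrow> coprime v1 v2"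
  by auto

lemma reduction_1: "\<exists>(v1, v2)\<in>directions_1. p * v2 - q * v1 = 0 \<or>
    1 * \<bar>p * v2 - q * v1\<bar> * (v1\<^sup>2 + v2\<^sup>2) < 2 * \<bar>p * v1 + q * v2\<bar>"
  for p q :: int
  by simp arith

lemma reduction_3: "\<exists>(v1, v2)\<in>directions_3. p * v2 - q * v1 = 0 \<or>
    3 * \<bar>p * v2 - q * v1\<bar> * (v1\<^sup>2 + v2\<^sup>2) < 2 * \<bar>p * v1 + q * v2\<bar>"
  for p q :: int
  by simp (smt (verit))

lemma reduction_4: "\<exists>(v1, v2)\<in>directions_4.
    p * v2 - q * v1 = 0 \<or> 4 * \<bar>p * v2 - q * v1\<bar> * (v1\<^sup>2 + v2\<^sup>2) < 2 * \<bar>p * v1 + q * v2\<bar>"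
  for p q :: int
  by simp (smt (verit))

text \<open>
  In the four proofs below, the frame \<open>q\<close> and the programs were found by a computer search among
  orthogonal pairs of short vectors in the orbit. In each list of coordinates the vectors with last
  entry 0 that come in pairs with equal middle entries serve the first Heisenberg group, the pairs
  with first entry 0 serve the second one, and the last few vectors provide the directions.
\<close>

lemma has_reducing_frame_3_4:
  assumes "hypergeometric_monoid 3 4 H"
  shows "hypergeometric_monoid.has_reducing_frame H"
proof -
  interpret hypergeometric_monoid 3 4 H by (rule assms)
  define q :: "z4 \<times> z4 \<times> z4 \<times> z4"
    where "q = ((0, 1, 1, - 1), (2, 6, 4, - 5), (- 11, - 30, - 19, 25), (6, 2, - 3, - 2))"
  have q: "sp (coords q x) (coords q y) = 1 * sp x y" for x y
    by (cases x; cases y) (simp add: q_def coords_def algebra_simps)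
  have "certified 3 4 1
     ((0, 1, 1, - 1), (2, 6, 4, - 5), (- 11, - 30, - 19, 25), (6, 2, - 3, - 2))
     [
      Fwd 0, Fwd 1, Sub 2 0, Bwd 0, Bwd 4, Add 5 4, Sub 3 6, Add 7 0, Add 8 1, Sub 1 0,
      Sub 4 10, Add 11 6, Bwd 12, Sub 5 0, Sub 14 12, Sub 15 0, Sub 2 1, Add 2 0, Add 1 0,
      Sub 18 19, Add 7 9, Add 4 9]
     [
      (- 21, 41, 7, 0), (- 33, 41, 7, 0), (- 51, 96, 17, 0), (- 63, 96, 17, 0), (0, 59, 12, 0),
      (0, 59, 12, 3), (0, 47, 12, 0), (0, 47, 12, 3), (0, 1, 0, 0), (21, 0, 1, 0)]"
    by code_simp
  from certified_transv_coords[OF q[unfolded q_def] _ this]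
  have w: "set [
      (- 21, 41, 7, 0), (- 33, 41, 7, 0), (- 51, 96, 17, 0), (- 63, 96, 17, 0), (0, 59, 12, 0),
      (0, 59, 12, 3), (0, 47, 12, 0), (0, 47, 12, 3), (0, 1, 0, 0), (21, 0, 1, 0)] \<subseteq> transv_coords 1 q"
    unfolding q_def by simp
  have "liftable 1 q (1, 0)" by (rule liftable_transv_coords[of "0"]) (use w in simp)
  moreover
  have "liftable 1 q (0, 1)" by (rule liftable_transv_coords[of "21"]) (use w in simp)
  ultimately have lift: "liftable 1 q v" if "v \<in> directions_1" for v
    using that by auto
  have "\<exists>N. reducing_monoid (adapted q) N 1 directions_1"
  proof (rule reducing_adapted[where ?y1.0 = "- 21" and y1' = "- 33" and ?a1.0 = "41" and ?b1.0 = "7"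
        and ?y2.0 = "- 51" and y2' = "- 63" and ?a2.0 = "96" and ?b2.0 = "17"
        and ?y3.0 = "0" and y3' = "3" and ?a3.0 = "59" and ?b3.0 = "12"
        and ?y4.0 = "0" and y4' = "3" and ?a4.0 = "47" and ?b4.0 = "12", OF q])
    show "liftable 1 q v" if "v \<in> directions_1" for v by (rule lift[OF that])
    show "coprime v1 v2" if "(v1, v2) \<in> directions_1" for v1 v2 using that by (rule coprime_directions)
    show "\<exists>(v1, v2)\<in>directions_1. p * v2 - q * v1 = 0 \<or>
        1 * \<bar>p * v2 - q * v1\<bar> * (v1\<^sup>2 + v2\<^sup>2) < 2 * \<bar>p * v1 + q * v2\<bar>" for p q
      by (rule reduction_1)
  qed (use w in simp_all)
  then show ?thesis
    unfolding q_def by (rule has_reducing_frameI[OF _ q[unfolded q_def], rotated - 1]) (simp_all add: coords_def)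
qed

lemma has_reducing_frame_6_5:
  assumes "hypergeometric_monoid 6 5 H"
  shows "hypergeometric_monoid.has_reducing_frame H"
proof -
  interpret hypergeometric_monoid 6 5 H by (rule assms)
  define q :: "z4 \<times> z4 \<times> z4 \<times> z4"
    where "q = ((0, 0, 1, 0), (1, 0, 1, 1), (0, 0, 0, 1), (0, - 1, - 2, - 1))"
  have q: "sp (coords q x) (coords q y) = 1 * sp x y" for x y
    by (cases x; cases y) (simp add: q_def coords_def algebra_simps)
  have "certified 6 5 1
     ((0, 0, 1, 0), (1, 0, 1, 1), (0, 0, 0, 1), (0, - 1, - 2, - 1))
     [
      Bwd 0, Bwd 1, Add 2 0, Add 1 0, Add 3 4, Fwd 0, Add 5 6, Fwd 7, Add 8 0, Fwd 6, Sub 10 0,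
      Sub 6 0, Sub 11 12, Fwd 13, Add 9 14, Sub 15 12, Sub 14 0, Sub 16 17, Sub 18 17, Fwd 17,
      Sub 20 14, Add 4 0, Add 21 22, Sub 13 1, Add 23 24, Add 25 24, Bwd 26, Add 27 0,
      Sub 12 0, Add 28 29, Sub 1 0, Sub 30 31, Fwd 32, Add 33 17, Sub 19 0, Add 35 1, Add 34 0,
      Add 19 4, Add 19 14, Add 35 17]
     [
      (18, - 4, 5, 0), (12, - 4, 5, 0), (18, - 4, 1, 0), (12, - 4, 1, 0), (0, - 5, - 1, 0),
      (0, - 5, - 1, - 6), (0, - 5, 4, 0), (0, - 5, 4, - 6), (6, 1, 0, 0), (0, 0, 1, 0)]"
    by code_simp
  from certified_transv_coords[OF q[unfolded q_def] _ this]
  have w: "set [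
      (18, - 4, 5, 0), (12, - 4, 5, 0), (18, - 4, 1, 0), (12, - 4, 1, 0), (0, - 5, - 1, 0),
      (0, - 5, - 1, - 6), (0, - 5, 4, 0), (0, - 5, 4, - 6), (6, 1, 0, 0), (0, 0, 1, 0)] \<subseteq> transv_coords 1 q"
    unfolding q_def by simp
  have "liftable 1 q (1, 0)" by (rule liftable_transv_coords[of "6"]) (use w in simp)
  moreover
  have "liftable 1 q (0, 1)" by (rule liftable_transv_coords[of "0"]) (use w in simp)
  ultimately have lift: "liftable 1 q v" if "v \<in> directions_1" for v
    using that by auto
  have "\<exists>N. reducing_monoid (adapted q) N 1 directions_1"
  proof (rule reducing_adapted[where ?y1.0 = "18" and y1' = "12" and ?a1.0 = "- 4" and ?b1.0 = "5"
        and ?y2.0 = "18" and y2' = "12" and ?a2.0 = "- 4" and ?b2.0 = "1"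
        and ?y3.0 = "0" and y3' = "- 6" and ?a3.0 = "- 5" and ?b3.0 = "- 1"
        and ?y4.0 = "0" and y4' = "- 6" and ?a4.0 = "- 5" and ?b4.0 = "4", OF q])
    show "liftable 1 q v" if "v \<in> directions_1" for v by (rule lift[OF that])
    show "coprime v1 v2" if "(v1, v2) \<in> directions_1" for v1 v2 using that by (rule coprime_directions)
    show "\<exists>(v1, v2)\<in>directions_1. p * v2 - q * v1 = 0 \<or>
        1 * \<bar>p * v2 - q * v1\<bar> * (v1\<^sup>2 + v2\<^sup>2) < 2 * \<bar>p * v1 + q * v2\<bar>" for p q
      by (rule reduction_1)
  qed (use w in simp_all)
  then show ?thesis
    unfolding q_def by (rule has_reducing_frameI[OF _ q[unfolded q_def], rotated - 1]) (simp_all add: coords_def)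
qed

lemma has_reducing_frame_4_4:
  assumes "hypergeometric_monoid 4 4 H"
  shows "hypergeometric_monoid.has_reducing_frame H"
proof -
  interpret hypergeometric_monoid 4 4 H by (rule assms)
  define q :: "z4 \<times> z4 \<times> z4 \<times> z4"
    where "q = ((0, 0, 1, - 1), (0, 0, 1, 0), (- 4, - 4, 1, 3), (4, 0, - 2, - 1))"
  have q: "sp (coords q x) (coords q y) = 4 * sp x y" for x y
    by (cases x; cases y) (simp add: q_def coords_def algebra_simps)
  have "certified 4 4 4
     ((0, 0, 1, - 1), (0, 0, 1, 0), (- 4, - 4, 1, 3), (4, 0, - 2, - 1))
     [
      Fwd 0, Sub 1 0, Fwd 1, Sub 3 0, Sub 4 2, Bwd 0, Bwd 6, Add 7 6, Fwd 3, Sub 9 1, Sub 3 1,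
      Sub 10 11, Fwd 12, Sub 13 0, Sub 9 0, Sub 15 2, Sub 16 5, Fwd 17, Sub 18 0, Bwd 7,
      Add 20 6, Add 21 8, Bwd 22, Bwd 23, Bwd 24, Bwd 25, Add 1 0, Sub 26 0, Fwd 13, Fwd 29,
      Add 30 6, Add 2 6]
     [
      (- 4, 8, - 1, 0), (- 8, 8, - 1, 0), (0, 4, - 1, 0), (- 4, 4, - 1, 0), (0, - 5, - 1, 0),
      (0, - 5, - 1, - 4), (0, 4, - 1, 4), (- 1, 1, 0, 0), (0, 0, 1, 0), (- 2, 1, - 1, 0),
      (0, 1, 1, 0), (- 3, 1, 2, 0), (- 3, 1, - 2, 0)]"
    by code_simp
  from certified_transv_coords[OF q[unfolded q_def] _ this]
  have w: "set [
      (- 4, 8, - 1, 0), (- 8, 8, - 1, 0), (0, 4, - 1, 0), (- 4, 4, - 1, 0), (0, - 5, - 1, 0),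
      (0, - 5, - 1, - 4), (0, 4, - 1, 4), (- 1, 1, 0, 0), (0, 0, 1, 0), (- 2, 1, - 1, 0),
      (0, 1, 1, 0), (- 3, 1, 2, 0), (- 3, 1, - 2, 0)] \<subseteq> transv_coords 4 q"
    unfolding q_def by simp
  have "liftable 4 q (1, 0)" by (rule liftable_transv_coords[of "- 1"]) (use w in simp)
  moreover
  have "liftable 4 q (0, 1)" by (rule liftable_transv_coords[of "0"]) (use w in simp)
  moreover
  have "liftable 4 q (1, - 1)" by (rule liftable_transv_coords[of "- 2"]) (use w in simp)
  moreover
  have "liftable 4 q (1, 1)" by (rule liftable_transv_coords[of "0"]) (use w in simp)
  moreover
  have "liftable 4 q (1, 2)" by (rule liftable_transv_coords[of "- 3"]) (use w in simp)
  moreover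
  have "liftable 4 q (1, - 2)" by (rule liftable_transv_coords[of "- 3"]) (use w in simp)
  ultimately have lift: "liftable 4 q v" if "v \<in> directions_4" for v
    using that liftable_4[of q] by auto
  have "\<exists>N. reducing_monoid (adapted q) N 4 directions_4"
  proof (rule reducing_adapted[where ?y1.0 = "- 4" and y1' = "- 8" and ?a1.0 = "8" and ?b1.0 = "- 1"
        and ?y2.0 = "0" and y2' = "- 4" and ?a2.0 = "4" and ?b2.0 = "- 1"
        and ?y3.0 = "0" and y3' = "- 4" and ?a3.0 = "- 5" and ?b3.0 = "- 1"
        and ?y4.0 = "0" and y4' = "4" and ?a4.0 = "4" and ?b4.0 = "- 1", OF q])
    show "liftable 4 q v" if "v \<in> directions_4" for v by (rule lift[OF that])
    show "coprime v1 v2" if "(v1, v2) \<in> directions_4" for v1 v2 using that by (rule coprime_directions)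
    show "\<exists>(v1, v2)\<in>directions_4. p * v2 - q * v1 = 0 \<or>
        4 * \<bar>p * v2 - q * v1\<bar> * (v1\<^sup>2 + v2\<^sup>2) < 2 * \<bar>p * v1 + q * v2\<bar>" for p q
      by (rule reduction_4)
  qed (use w in simp_all)
  then show ?thesis
    unfolding q_def by (rule has_reducing_frameI[OF _ q[unfolded q_def], rotated - 1]) (simp_all add: coords_def)
qed

lemma has_reducing_frame_9_6:
  assumes "hypergeometric_monoid 9 6 H"
  shows "hypergeometric_monoid.has_reducing_frame H"
proof -
  interpret hypergeometric_monoid 9 6 H by (rule assms)
  define q :: "z4 \<times> z4 \<times> z4 \<times> z4"
    where "q = ((0, 3, 0, - 2), (0, 0, 0, 1), (- 3, 9, 2, - 8), (0, 0, 1, 3))"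
  have q: "sp (coords q x) (coords q y) = 3 * sp x y" for x y
    by (cases x; cases y) (simp add: q_def coords_def algebra_simps)
  have "certified 9 6 3
     ((0, 3, 0, - 2), (0, 0, 0, 1), (- 3, 9, 2, - 8), (0, 0, 1, 3))
     [
      Fwd 0, Fwd 1, Fwd 2, Sub 3 0, Sub 2 0, Sub 4 5, Sub 1 0, Sub 6 7, Fwd 8, Bwd 0, Bwd 10,
      Bwd 11, Add 12 0, Add 11 0, Add 13 14, Add 10 0, Add 15 16, Bwd 17, Sub 18 0, Sub 19 0,
      Sub 20 0, Sub 2 1, Sub 22 16, Sub 23 14, Bwd 24, Add 25 0, Bwd 26, Sub 10 0, Add 27 28,
      Add 29 28, Sub 11 0, Add 30 31, Add 32 28, Add 33 28, Add 14 16, Sub 35 22, Sub 36 22,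
      Sub 37 0, Fwd 38, Sub 39 0, Fwd 40, Add 41 0, Add 27 0, Add 43 10, Add 44 10, Add 45 10,
      Add 11 10, Add 46 47, Add 48 10, Add 42 0, Sub 36 0, Sub 51 47, Add 52 10, Add 53 10,
      Add 9 0, Add 55 0, Add 56 0, Add 57 0, Sub 52 0, Add 59 28, Add 60 28]
     [
      (54, 19, - 6, 0), (0, 19, - 6, 0), (54, 37, - 6, 0), (0, 37, - 6, 0), (0, - 12, 1, 6),
      (0, - 12, 1, 0), (0, - 9, 1, 6), (0, - 9, 1, 0), (0, 1, 0, 0), (0, 0, 1, 0),
      (- 12, 1, 1, 0)]"
    by code_simp
  from certified_transv_coords[OF q[unfolded q_def] _ this]
  have w: "set [
      (54, 19, - 6, 0), (0, 19, - 6, 0), (54, 37, - 6, 0), (0, 37, - 6, 0), (0, - 12, 1, 6),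
      (0, - 12, 1, 0), (0, - 9, 1, 6), (0, - 9, 1, 0), (0, 1, 0, 0), (0, 0, 1, 0),
      (- 12, 1, 1, 0)] \<subseteq> transv_coords 3 q"
    unfolding q_def by simp
  have "liftable 3 q (1, 0)" by (rule liftable_transv_coords[of "0"]) (use w in simp)
  moreover
  have "liftable 3 q (0, 1)" by (rule liftable_transv_coords[of "0"]) (use w in simp)
  moreover
  have "liftable 3 q (1, 1)" by (rule liftable_transv_coords[of "- 12"]) (use w in simp)
  ultimately have lift: "liftable 3 q v" if "v \<in> directions_3" for v
    using that liftable_3[of q] by auto
  have "\<exists>N. reducing_monoid (adapted q) N 3 directions_3"
  proof (rule reducing_adapted[where ?y1.0 = "54" and y1' = "0" and ?a1.0 = "19" and ?b1.0 = "- 6"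
        and ?y2.0 = "54" and y2' = "0" and ?a2.0 = "37" and ?b2.0 = "- 6"
        and ?y3.0 = "6" and y3' = "0" and ?a3.0 = "- 12" and ?b3.0 = "1"
        and ?y4.0 = "6" and y4' = "0" and ?a4.0 = "- 9" and ?b4.0 = "1", OF q])
    show "liftable 3 q v" if "v \<in> directions_3" for v by (rule lift[OF that])
    show "coprime v1 v2" if "(v1, v2) \<in> directions_3" for v1 v2 using that by (rule coprime_directions)
    show "\<exists>(v1, v2)\<in>directions_3. p * v2 - q * v1 = 0 \<or>
        3 * \<bar>p * v2 - q * v1\<bar> * (v1\<^sup>2 + v2\<^sup>2) < 2 * \<bar>p * v1 + q * v2\<bar>" for p q
      by (rule reduction_3)
  qed (use w in simp_all)
  then show ?thesis
    unfolding q_def by (rule has_reducing_frameI[OF _ q[unfolded q_def], rotated - 1]) (simp_all add: coords_def)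
qed

section \<open>Integer matrices\<close>

lemma finite_bounded_vectors:
  assumes "finite S"
  shows "finite {x :: 'a ^ 'n. \<forall>i. x $ i \<in> S}"
proof -
  have "{x :: 'a ^ 'n. \<forall>i. x $ i \<in> S} \<subseteq> vec_lambda ` (UNIV \<rightarrow>\<^sub>E S)"
  proof
    fix x :: "'a ^ 'n" assume "x \<in> {x. \<forall>i. x $ i \<in> S}"
    then show "x \<in> vec_lambda ` (UNIV \<rightarrow>\<^sub>E S)"
      by (intro image_eqI[of _ _ "vec_nth x"]) auto
  qed
  moreover have "finite ((UNIV :: 'n set) \<rightarrow>\<^sub>E S)" using assms by (intro finite_PiE) auto
  ultimately show ?thesis using finite_subset by blast
qed

lemma det_map_matrix_of_int: "det (map_matrix of_int M :: 'a::comm_ring_1 ^ 'n ^ 'n) = of_int (det M)"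
  by (simp add: det_def of_int_sum of_int_prod)

lemma map_matrix_of_int_mult:
  "map_matrix of_int (M ** N) = (map_matrix of_int M ** map_matrix of_int N :: 'a::comm_ring_1 ^ 'n ^ 'n)"
  by (simp add: vec_eq_iff matrix_matrix_mult_def)

lemma map_matrix_of_int_one: "map_matrix of_int (mat 1) = (mat 1 :: 'a::comm_ring_1 ^ 'n ^ 'n)"
  by (simp add: vec_eq_iff mat_def)

lemma map_matrix_of_int_inject:
  "map_matrix of_int M = (map_matrix of_int N :: 'a::ring_char_0 ^ 'n ^ 'n) \<longleftrightarrow> M = N"
  by (simp add: vec_eq_iff)

text \<open>By Cramer's rule the entries of the inverse are determinants of integer matrices.\<close>

lemma int_matrix_inverse:
  fixes M :: "int ^ 'n ^ 'n"
  assumes "det M = 1"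
  obtains N where "M ** N = mat 1" "N ** M = mat 1" "det N = 1"
proof -
  let ?R = "map_matrix of_int :: int ^ 'n ^ 'n \<Rightarrow> rat ^ 'n ^ 'n"
  define cof where "cof = (\<lambda>k j. (\<chi> i l. if l = k then (if i = j then 1 else 0) else M $ i $ l) :: int ^ 'n ^ 'n)"
  define N :: "int ^ 'n ^ 'n" where "N = (\<chi> k j. det (cof k j))"
  have detR: "det (?R M) = 1" using assms by (simp add: det_map_matrix_of_int)
  have "?R M ** ?R N = mat 1"
  proof -
    have col: "?R M *v (\<chi> k. of_int (N $ k $ j)) = (\<chi> i. if i = j then 1 else 0)" for j
    proof (subst cramer)
      show "det (?R M) \<noteq> 0" using detR by simp
      have eq: "(\<chi> i l. if l = k then (\<chi> i. if i = j then 1 else 0) $ i else ?R M $ i $ l) = ?R (cof k j)" for k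
        by (simp add: vec_eq_iff cof_def)
      show "(\<chi> k. of_int (N $ k $ j)) =
          (\<chi> k. det (\<chi> i l. if l = k then (\<chi> i. if i = j then 1 else 0) $ i else ?R M $ i $ l) / det (?R M))"
        unfolding detR eq by (simp add: N_def det_map_matrix_of_int)
    qed
    show ?thesis
      using col by (simp add: vec_eq_iff matrix_matrix_mult_def matrix_vector_mult_def mat_def)
  qed
  then have "?R (M ** N) = ?R (mat 1)" and "?R (N ** M) = ?R (mat 1)"
    unfolding map_matrix_of_int_mult map_matrix_of_int_one by (simp_all add: matrix_left_right_inverse)
  then have "M ** N = mat 1" "N ** M = mat 1" unfolding map_matrix_of_int_inject by simp_all
  moreover from this have "det N = 1" using assms det_mul[of M N] by simp
  ultimately show ?thesis using that by blast
qed

section \<open>From the companion lattice to the symplectic lattice\<close>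

lemma companion_quartic:
  "companion [:c0, c1, c2, c3, 1:] = vector
     [vector [0, 0, 0, - c0], vector [1, 0, 0, - c1], vector [0, 1, 0, - c2], vector [0, 0, 1, - c3]]"
  by (simp add: companion_def numeral_2_eq_2 numeral_3_eq_3)

lemma companion_vector_mult:
  "(companion [:c0, c1, c2, c3, 1:] *v x) $ 1 = - c0 * x $ 4"
  "(companion [:c0, c1, c2, c3, 1:] *v x) $ 2 = x $ 1 - c1 * x $ 4"
  "(companion [:c0, c1, c2, c3, 1:] *v x) $ 3 = x $ 2 - c2 * x $ 4"
  "(companion [:c0, c1, c2, c3, 1:] *v x) $ 4 = x $ 3 - c3 * x $ 4"
  by (simp_all add: companion_quartic matrix_vector_mult_def sum_4)

lemma matrix_vector_scale: "M *v (c *s x) = c *s (M *v x)" for M :: "'a::comm_semiring_1 ^ 'n ^ 'm"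
  by (simp add: vec_eq_iff matrix_vector_mult_def sum_distrib_left mult_ac)

lemma vector_scale_cancel: "c \<noteq> 0 \<Longrightarrow> c *s x = c *s y \<longleftrightarrow> x = y" for x :: "'a::idom ^ 'n"
  by (simp add: vec_eq_iff)

abbreviation companion_A :: "int ^ 4 ^ 4" where
  "companion_A \<equiv> companion [:1, - 4, 6, - 4, 1:]"

abbreviation companion_B :: "int \<Rightarrow> int \<Rightarrow> int ^ 4 ^ 4" where
  "companion_B d k \<equiv> companion [:1, k - 4, 6 + d - 2 * k, k - 4, 1:]"

text \<open>
  The map \<open>to_z4\<close> sends the basis \<open>x, A x, A\<^sup>2 x, A\<^sup>3 x\<close> of the companion lattice to the orbit of
  \<open>(0, - k, 1, 1)\<close> under \<open>shift\<close>. This vector and its first two translates are fixed by the transvection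
  along \<open>e\<close>, as \<open>A\<close> and \<open>B\<close> agree on the first three basis vectors. Up to the factor \<open>d\<close>,
  the map \<open>from_z4\<close> is its inverse.
\<close>

definition to_z4 :: "int \<Rightarrow> int \<Rightarrow> int ^ 4 \<Rightarrow> z4" where
  "to_z4 d k x = (d * x $ 4, - k * x $ 1 - k * x $ 2 + (d - k) * x $ 3 + (3 * d - k) * x $ 4,
     x $ 1 - x $ 3 - 2 * x $ 4, x $ 1 + x $ 2 + x $ 3 + x $ 4)"

definition from_z4 :: "int \<Rightarrow> int \<Rightarrow> z4 \<Rightarrow> int ^ 4" where
  "from_z4 d k = (\<lambda>(z1, z2, z3, z4). vector [- z1 + z2 + d * z3 + k * z4,
     3 * z1 - 2 * z2 - d * z3 + (d - 2 * k) * z4, - 3 * z1 + z2 + k * z4, z1])"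

lemma to_from_z4: "to_z4 d k (from_z4 d k z) = scale4 d z"
  by (cases z) (simp add: to_z4_def from_z4_def algebra_simps)

lemma from_to_z4: "from_z4 d k (to_z4 d k x) = d *s x"
  by (simp add: to_z4_def from_z4_def vec_eq_iff forall_4 algebra_simps)

lemma to_z4_linear: "to_z4 d k (x + c *s y) = to_z4 d k x + scale4 c (to_z4 d k y)"
  by (simp add: to_z4_def algebra_simps)

lemma to_z4_A: "to_z4 d k (companion_A *v x) = shift d k (to_z4 d k x)"
  by (simp add: to_z4_def shift_def companion_vector_mult) (simp add: algebra_simps)

lemma to_z4_B: "to_z4 d k (companion_B d k *v x) = shift d k (transv (- 1) (0, 0, 0, 1) (to_z4 d k x))"
  by (simp add: to_z4_def shift_def companion_vector_mult Let_def) (simp add: algebra_simps)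

lemma inj_to_z4:
  assumes "d \<noteq> 0" and "to_z4 d k x = to_z4 d k y"
  shows "x = y"
proof -
  have "d *s x = d *s y"
    using arg_cong[OF assms(2), of "from_z4 d k"] unfolding from_to_z4 .
  then show ?thesis unfolding vector_scale_cancel[OF assms(1)] .
qed

definition companion_form :: "int \<Rightarrow> int \<Rightarrow> int ^ 4 \<Rightarrow> int ^ 4 \<Rightarrow> int" where
  "companion_form d k x y = sp (to_z4 d k x) (to_z4 d k y)"

definition isometries :: "int \<Rightarrow> int \<Rightarrow> (int ^ 4 ^ 4) set" where
  "isometries d k = {M. det M = 1 \<and> (\<forall>x y. companion_form d k (M *v x) (M *v y) = companion_form d k x y)}"

lemma isometries_mult: "M \<in> isometries d k \<Longrightarrow> N \<in> isometries d k \<Longrightarrow> M ** N \<in> isometries d k"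
  by (simp add: isometries_def det_mul flip: matrix_vector_mul_assoc)

lemma isometries_inverse:
  assumes "M \<in> isometries d k"
  obtains N where "M ** N = mat 1" "N ** M = mat 1" "N \<in> isometries d k"
proof -
  obtain N where N: "M ** N = mat 1" "N ** M = mat 1" "det N = 1"
    using assms int_matrix_inverse[of M] by (auto simp: isometries_def)
  have "companion_form d k (N *v x) (N *v y) = companion_form d k (M *v (N *v x)) (M *v (N *v y))" for x y
    using assms by (simp add: isometries_def)
  then have "N \<in> isometries d k"
    using N by (simp add: isometries_def matrix_vector_mul_assoc)
  then show ?thesis using N that by blast
qed

section \<open>Finite index\<close>

lemma finite_image_factor:
  assumes "finite (f ` K)" and "\<And>x y. x \<in> K \<Longrightarrow> y \<in> K \<Longrightarrow> f x = f y \<Longrightarrow> c x = c y"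
  shows "finite (c ` K)"
proof -
  have "c ` K \<subseteq> (\<lambda>v. c (SOME x. x \<in> K \<and> f x = v)) ` (f ` K)"
  proof
    fix u assume "u \<in> c ` K"
    then obtain x where x: "x \<in> K" "u = c x" by blast
    let ?x = "SOME y. y \<in> K \<and> f y = f x"
    have "?x \<in> K \<and> f ?x = f x" by (rule someI[of _ x]) (use x in simp)
    then have "c ?x = c x" using assms(2) x by blast
    then show "u \<in> (\<lambda>v. c (SOME x. x \<in> K \<and> f x = v)) ` (f ` K)"
      unfolding image_image using x by (intro image_eqI[of _ _ x]) simp_all
  qed
  then show ?thesis using assms(1) finite_subset by blast
qed

text \<open>The group \<open>\<Gamma>\<close> of the theorem, as a group of integer matrices.\<close>

locale companion_group =
  fixes d k :: int and \<Gamma> :: "(int ^ 4 ^ 4) set"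
  assumes d: "d \<noteq> 0"
    and one: "mat 1 \<in> \<Gamma>" and mult: "M \<in> \<Gamma> \<Longrightarrow> N \<in> \<Gamma> \<Longrightarrow> M ** N \<in> \<Gamma>"
    and inverse: "M \<in> \<Gamma> \<Longrightarrow> \<exists>N\<in>\<Gamma>. M ** N = mat 1 \<and> N ** M = mat 1"
    and A: "companion_A \<in> \<Gamma>" and B: "companion_B d k \<in> \<Gamma>"
    and has_reducing_frame: "\<And>H. hypergeometric_monoid d k H \<Longrightarrow> hypergeometric_monoid.has_reducing_frame H"
begin

definition induced :: "(z4 \<Rightarrow> z4) set" where
  "induced = {h. \<exists>M\<in>\<Gamma>. \<forall>x. to_z4 d k (M *v x) = h (to_z4 d k x)}"

lemma induced_comp: "g \<in> induced \<Longrightarrow> h \<in> induced \<Longrightarrow> g \<circ> h \<in> induced"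
proof -
  assume "g \<in> induced" "h \<in> induced"
  then obtain M N where M: "M \<in> \<Gamma>" "\<And>x. to_z4 d k (M *v x) = g (to_z4 d k x)"
    and N: "N \<in> \<Gamma>" "\<And>x. to_z4 d k (N *v x) = h (to_z4 d k x)"
    by (auto simp: induced_def)
  then have "\<forall>x. to_z4 d k ((M ** N) *v x) = (g \<circ> h) (to_z4 d k x)"
    by (simp flip: matrix_vector_mul_assoc)
  then show ?thesis using mult[OF M(1) N(1)] by (auto simp: induced_def)
qed

lemma induced_inverse:
  assumes "h \<in> induced" and "\<And>z. h' (h z) = z"
  shows "h' \<in> induced"
proof -
  obtain M where M: "M \<in> \<Gamma>" "\<And>x. to_z4 d k (M *v x) = h (to_z4 d k x)"
    using assms(1) by (auto simp: induced_def)
  obtain N where N: "N \<in> \<Gamma>" "M ** N = mat 1" using inverse[OF M(1)] by blast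
  have "to_z4 d k (N *v x) = h' (to_z4 d k x)" for x
  proof -
    have "h (to_z4 d k (N *v x)) = to_z4 d k x"
      using M(2)[of "N *v x"] by (simp add: matrix_vector_mul_assoc N(2))
    then show ?thesis using assms(2) by metis
  qed
  then show ?thesis using N(1) by (auto simp: induced_def)
qed

lemma induced_monoid: "hypergeometric_monoid d k induced"
proof
  show "id \<in> induced" using one by (auto simp: induced_def intro!: bexI[of _ "mat 1"])
  show "g \<in> induced \<Longrightarrow> h \<in> induced \<Longrightarrow> g \<circ> h \<in> induced" for g h by (rule induced_comp)
  show shift: "shift d k \<in> induced" using A to_z4_A by (auto simp: induced_def)
  show shift_inv: "shift_inv d k \<in> induced"
    by (rule induced_inverse[OF shift]) (rule shift_inverse)
  have "shift d k \<circ> transv (- 1) (0, 0, 0, 1) \<in> induced"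
    using B to_z4_B[of d k] by (auto simp: induced_def)
  then have "shift_inv d k \<circ> (shift d k \<circ> transv (- 1) (0, 0, 0, 1)) \<in> induced"
    by (rule induced_comp[OF shift_inv])
  moreover have "shift_inv d k \<circ> (shift d k \<circ> transv (- 1) (0, 0, 0, 1)) = transv (- 1) (0, 0, 0, 1)"
    by (simp add: fun_eq_iff shift_inverse)
  ultimately show t: "transv (- 1) (0, 0, 0, 1) \<in> induced" by simp
  show "transv 1 (0, 0, 0, 1) \<in> induced"
    by (rule induced_inverse[OF t]) (use transv_inverse[of "- 1"] in simp)
qed

text \<open>
  Let \<open>x1, ..., x4\<close> be the vectors whose coordinates in the frame are \<open>s\<close> times the unit vectors. An isometry
  \<open>M\<close> that is congruent to 1 modulo \<open>s N\<^sup>2\<close> maps them to \<open>s\<close> times an integral symplectic frame whose first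
  vector is a unit vector modulo \<open>N\<^sup>2\<close>; so \<open>g M\<close> maps them to bounded vectors for some \<open>g \<in> \<Gamma>\<close>. For
  arbitrary \<open>M\<close> one first multiplies by the inverse of a representative \<open>M0\<close> of its residue class. The
  residue and the four bounded vectors take finitely many values, and determine the coset of \<open>M\<close>.
\<close>

theorem finite_cosets: "finite ((\<lambda>M. (\<lambda>g. g ** M) ` \<Gamma>) ` isometries d k)"
proof -
  interpret hypergeometric_monoid d k induced by (rule induced_monoid)
  obtain q1 q2 q3 q4 \<mu> N V where mu: "\<mu> > 0"
    and form: "\<And>x y. sp (coords (q1, q2, q3, q4) x) (coords (q1, q2, q3, q4) y) = \<mu> * sp x y"
    and q: "coords (q1, q2, q3, q4) q1 = (\<mu>, 0, 0, 0)" "coords (q1, q2, q3, q4) q2 = (0, \<mu>, 0, 0)"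
      "coords (q1, q2, q3, q4) q3 = (0, 0, \<mu>, 0)" "coords (q1, q2, q3, q4) q4 = (0, 0, 0, \<mu>)"
    and red: "reducing_monoid (adapted (q1, q2, q3, q4)) N \<mu> V"
    using has_reducing_frame[OF induced_monoid] unfolding has_reducing_frame_def by blast
  define Q where "Q = (q1, q2, q3, q4)"
  interpret red: reducing_monoid "adapted Q" N \<mu> V using red by (simp add: Q_def)
  define \<Theta> where "\<Theta> x = coords Q (to_z4 d k x)" for x
  define s where "s = d * \<mu>"
  have s0: "s \<noteq> 0" using d mu by (simp add: s_def)
  have N0: "N\<^sup>2 \<noteq> 0" using red.N by simp
  have lin: "\<Theta> (x + c *s y) = \<Theta> x + scale4 c (\<Theta> y)" for x y c
    using linear4_coords[of Q] by (simp add: \<Theta>_def to_z4_linear linear4_def)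
  have sp\<Theta>: "sp (\<Theta> x) (\<Theta> y) = \<mu> * companion_form d k x y" for x y
    using form[of "to_z4 d k x" "to_z4 d k y"] by (simp add: \<Theta>_def Q_def companion_form_def)
  define x1 x2 x3 x4 where "x1 = from_z4 d k q1" and "x2 = from_z4 d k q2"
    and "x3 = from_z4 d k q3" and "x4 = from_z4 d k q4"
  have \<Theta>x: "\<Theta> x1 = (s, 0, 0, 0)" "\<Theta> x2 = (0, s, 0, 0)" "\<Theta> x3 = (0, 0, s, 0)" "\<Theta> x4 = (0, 0, 0, s)"
    using q linear4_scale[OF linear4_coords[of Q]]
    by (simp_all add: \<Theta>_def x1_def x2_def x3_def x4_def to_from_z4 s_def Q_def)
  have inj: "x = y" if "\<Theta> x = \<Theta> y" for x y
  proof -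
    have "sp (to_z4 d k x) z = sp (to_z4 d k y) z" for z
    proof -
      have "\<mu> * sp (to_z4 d k x) (scale4 d z) = \<mu> * sp (to_z4 d k y) (scale4 d z)"
        using sp\<Theta>[of x "from_z4 d k z"] sp\<Theta>[of y "from_z4 d k z"]
        unfolding that companion_form_def to_from_z4 by linarith
      then show ?thesis using mu d by (simp add: sp_scale)
    qed
    from this[of "(1, 0, 0, 0)"] this[of "(0, 1, 0, 0)"] this[of "(0, 0, 1, 0)"] this[of "(0, 0, 0, 1)"]
    have "to_z4 d k x = to_z4 d k y"
      by (cases "to_z4 d k x"; cases "to_z4 d k y") simp
    then show ?thesis by (rule inj_to_z4[OF d])
  qed
  have expand: "s *s y = (case \<Theta> y of (a1, a2, a3, a4) \<Rightarrow> 0 + a1 *s x1 + a2 *s x2 + a3 *s x3 + a4 *s x4)" for y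
  proof (rule inj)
    have "\<Theta> 0 = (0, 0, 0, 0)" using lin[of 0 "- 1" 0] by (cases "\<Theta> 0") simp
    moreover from this have "\<Theta> (s *s y) = scale4 s (\<Theta> y)"
      using lin[of 0 s y] by (simp flip: zero_z4)
    ultimately show "\<Theta> (s *s y) = \<Theta> (case \<Theta> y of (a1, a2, a3, a4) \<Rightarrow> 0 + a1 *s x1 + a2 *s x2 + a3 *s x3 + a4 *s x4)"
      by (cases "\<Theta> y") (simp only: lin prod.case \<Theta>x, simp)
  qed
  have determined: "X = Y" if "X *v x1 = Y *v x1" "X *v x2 = Y *v x2" "X *v x3 = Y *v x3" "X *v x4 = Y *v x4"
    for X Y :: "int ^ 4 ^ 4"
  proof -
    have "X *v y = Y *v y" for y
    proof -
      have "X *v (s *s y) = Y *v (s *s y)"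
        unfolding expand[of y]
        by (cases "\<Theta> y") (simp add: that matrix_vector_right_distrib matrix_vector_scale vector_scale_cancel)
      then show ?thesis using s0 by (simp add: matrix_vector_scale vector_scale_cancel)
    qed
    then show ?thesis by (simp add: matrix_eq)
  qed
  obtain C where C: "\<forall>c1 c2 c3 c4. sp c1 c2 = 0 \<and> sp c1 c3 = 0 \<and> sp c1 c4 = 1 \<and>
     sp c2 c3 = 1 \<and> sp c2 c4 = 0 \<and> sp c3 c4 = 0 \<and>
     (\<exists>x1 x2 x3 x4. c1 = (1 + N\<^sup>2 * x1, N\<^sup>2 * x2, N\<^sup>2 * x3, N\<^sup>2 * x4)) \<longrightarrow>
     (\<exists>g\<in>adapted Q. entries_le C (g c1) \<and> entries_le C (g c2) \<and> entries_le C (g c3) \<and> entries_le C (g c4))"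
    using red.frames_bounded by blast
  define S where "S = scale4 s ` {x. entries_le C x}"
  have "finite {x. entries_le C x}"
  proof (rule finite_subset)
    show "{x. entries_le C x} \<subseteq> {- C..C} \<times> {- C..C} \<times> {- C..C} \<times> {- C..C}"
      by (auto simp: entries_le_def abs_le_iff)
  qed simp
  then have S: "finite S" by (simp add: S_def)
  define L where "L = s * N\<^sup>2"
  have L0: "L \<noteq> 0" using s0 N0 by (simp add: L_def)
  have near_one: "\<exists>g\<in>\<Gamma>. \<Theta> ((g ** M) *v x1) \<in> S \<and> \<Theta> ((g ** M) *v x2) \<in> S \<and>
      \<Theta> ((g ** M) *v x3) \<in> S \<and> \<Theta> ((g ** M) *v x4) \<in> S"
    if M: "M \<in> isometries d k" and X: "\<And>x. M *v x = x + L *s (X *v x)" for M X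
  proof -
    have \<Theta>M: "\<Theta> (M *v x) = scale4 s (y + scale4 (N\<^sup>2) (\<Theta> (X *v x)))" if "\<Theta> x = scale4 s y" for x y
      unfolding X lin L_def that by (simp add: scale4_add)
    define c1 c2 c3 c4 where "c1 = (1, 0, 0, 0) + scale4 (N\<^sup>2) (\<Theta> (X *v x1))"
      and "c2 = (0, 1, 0, 0) + scale4 (N\<^sup>2) (\<Theta> (X *v x2))"
      and "c3 = (0, 0, 1, 0) + scale4 (N\<^sup>2) (\<Theta> (X *v x3))"
      and "c4 = (0, 0, 0, 1) + scale4 (N\<^sup>2) (\<Theta> (X *v x4))"
    have c: "\<Theta> (M *v x1) = scale4 s c1" "\<Theta> (M *v x2) = scale4 s c2"
      "\<Theta> (M *v x3) = scale4 s c3" "\<Theta> (M *v x4) = scale4 s c4"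
      unfolding c1_def c2_def c3_def c4_def by (rule \<Theta>M; simp add: \<Theta>x)+
    have spM: "sp (\<Theta> (M *v x)) (\<Theta> (M *v y)) = sp (\<Theta> x) (\<Theta> y)" for x y
      using M by (simp add: sp\<Theta> isometries_def)
    have "sp c1 c2 = 0" "sp c1 c3 = 0" "sp c1 c4 = 1" "sp c2 c3 = 1" "sp c2 c4 = 0" "sp c3 c4 = 0"
      using spM[of x1 x2] spM[of x1 x3] spM[of x1 x4] spM[of x2 x3] spM[of x2 x4] spM[of x3 x4] s0
      unfolding c \<Theta>x sp_scale by simp_all
    moreover have "\<exists>x1 x2 x3 x4. c1 = (1 + N\<^sup>2 * x1, N\<^sup>2 * x2, N\<^sup>2 * x3, N\<^sup>2 * x4)"
      unfolding c1_def by (cases "\<Theta> (X *v x1)") auto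
    ultimately obtain g where g: "g \<in> adapted Q"
      and bound: "entries_le C (g c1)" "entries_le C (g c2)" "entries_le C (g c3)" "entries_le C (g c4)"
      using C by blast
    obtain h where h: "h \<in> induced" "\<And>x. coords Q (h x) = g (coords Q x)" and g_lin: "linear4 g"
      using g by (auto simp: adapted_def)
    obtain G where G: "G \<in> \<Gamma>" "\<And>x. to_z4 d k (G *v x) = h (to_z4 d k x)"
      using h(1) by (auto simp: induced_def)
    have "\<Theta> ((G ** M) *v x) = g (\<Theta> (M *v x))" for x
      by (simp add: \<Theta>_def G(2) h(2) flip: matrix_vector_mul_assoc)
    then show ?thesis
      using G(1) bound by (intro bexI[of _ G]) (auto simp: c linear4_scale[OF g_lin] S_def)
  qed
  define residue where "residue M = map_matrix (\<lambda>a. a mod L) M" for M :: "int ^ 4 ^ 4"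
  have "finite (range residue)"
  proof (rule finite_subset)
    show "range residue \<subseteq> {R. \<forall>i. R $ i \<in> {r. \<forall>j. r $ j \<in> {- \<bar>L\<bar>..\<bar>L\<bar>}}}"
    proof -
      have "a mod L \<in> {- \<bar>L\<bar>..\<bar>L\<bar>}" for a
        using abs_mod_less[OF L0, of a] unfolding atLeastAtMost_iff by linarith
      then show ?thesis by (auto simp: residue_def)
    qed
    show "finite {R :: int ^ 4 ^ 4. \<forall>i. R $ i \<in> {r. \<forall>j. r $ j \<in> {- \<bar>L\<bar>..\<bar>L\<bar>}}}"
      by (intro finite_bounded_vectors) simp
  qed
  have "\<exists>N0. \<forall>M\<in>isometries d k. N0 (residue M) \<in> isometries d k \<and>
      (\<exists>M0. N0 (residue M) ** M0 = mat 1 \<and> M0 ** N0 (residue M) = mat 1 \<and> residue M0 = residue M)"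
  proof -
    have "\<exists>N0. N0 \<in> isometries d k \<and> (\<exists>M0. N0 ** M0 = mat 1 \<and> M0 ** N0 = mat 1 \<and> residue M0 = residue M)"
      if "M \<in> isometries d k" for M
      using isometries_inverse[OF that] by metis
    then have "\<forall>R. \<exists>N0. R \<in> residue ` isometries d k \<longrightarrow> N0 \<in> isometries d k \<and>
        (\<exists>M0. N0 ** M0 = mat 1 \<and> M0 ** N0 = mat 1 \<and> residue M0 = R)"
      by auto
    from choice[OF this] show ?thesis by blast
  qed
  then obtain N0 where N0: "\<And>M. M \<in> isometries d k \<Longrightarrow> N0 (residue M) \<in> isometries d k"
    and M0: "\<And>M. M \<in> isometries d k \<Longrightarrow>
      \<exists>M0. N0 (residue M) ** M0 = mat 1 \<and> M0 ** N0 (residue M) = mat 1 \<and> residue M0 = residue M"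
    by blast
  have "\<exists>g\<in>\<Gamma>. \<Theta> ((g ** (M ** N0 (residue M))) *v x1) \<in> S \<and> \<Theta> ((g ** (M ** N0 (residue M))) *v x2) \<in> S \<and>
      \<Theta> ((g ** (M ** N0 (residue M))) *v x3) \<in> S \<and> \<Theta> ((g ** (M ** N0 (residue M))) *v x4) \<in> S"
    if M: "M \<in> isometries d k" for M
  proof -
    obtain M0 where M0: "N0 (residue M) ** M0 = mat 1" "M0 ** N0 (residue M) = mat 1" "residue M0 = residue M"
      using M0[OF M] by blast
    define E where "E = (\<chi> i j. (M $ i $ j - M0 $ i $ j) div L)"
    have E: "M $ i $ j = M0 $ i $ j + L * E $ i $ j" for i j
    proof -
      have "residue M $ i $ j = residue M0 $ i $ j" using M0(3) by simp
      then have "L dvd M $ i $ j - M0 $ i $ j" by (simp add: residue_def mod_eq_dvd_iff)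
      then show ?thesis by (simp add: E_def)
    qed
    have Mv: "M *v y = M0 *v y + L *s (E *v y)" for y
      by (simp add: vec_eq_iff matrix_vector_mult_def E sum_4 algebra_simps)
    have "(M ** N0 (residue M)) *v x = x + L *s ((E ** N0 (residue M)) *v x)" for x
      using Mv[of "N0 (residue M) *v x"] M0(2) by (simp add: matrix_vector_mul_assoc)
    then show ?thesis by (rule near_one[OF isometries_mult[OF M N0[OF M]]])
  qed
  then obtain g where g: "\<And>M. M \<in> isometries d k \<Longrightarrow> g M \<in> \<Gamma>"
    and gS: "\<And>M. M \<in> isometries d k \<Longrightarrow> \<Theta> ((g M ** (M ** N0 (residue M))) *v x1) \<in> S"
      "\<And>M. M \<in> isometries d k \<Longrightarrow> \<Theta> ((g M ** (M ** N0 (residue M))) *v x2) \<in> S"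
      "\<And>M. M \<in> isometries d k \<Longrightarrow> \<Theta> ((g M ** (M ** N0 (residue M))) *v x3) \<in> S"
      "\<And>M. M \<in> isometries d k \<Longrightarrow> \<Theta> ((g M ** (M ** N0 (residue M))) *v x4) \<in> S"
    by metis
  define f where "f M = (residue M, \<Theta> ((g M ** (M ** N0 (residue M))) *v x1),
     \<Theta> ((g M ** (M ** N0 (residue M))) *v x2), \<Theta> ((g M ** (M ** N0 (residue M))) *v x3),
     \<Theta> ((g M ** (M ** N0 (residue M))) *v x4))" for M
  show ?thesis
  proof (rule finite_image_factor)
    have "f ` isometries d k \<subseteq> range residue \<times> S \<times> S \<times> S \<times> S"
      using gS by (auto simp: f_def)
    then show "finite (f ` isometries d k)"
      using \<open>finite (range residue)\<close> S by (meson finite_SigmaI finite_subset)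
  next
    fix M M' assume M: "M \<in> isometries d k" "M' \<in> isometries d k" and eq: "f M = f M'"
    have res: "residue M' = residue M" using eq by (simp add: f_def)
    obtain M0 where M0: "N0 (residue M) ** M0 = mat 1" using M0[OF M(1)] by blast
    have "g M ** (M ** N0 (residue M)) = g M' ** (M' ** N0 (residue M))"
      by (rule determined; rule inj) (use eq in \<open>simp_all add: f_def res\<close>)
    then have "g M ** (M ** N0 (residue M)) ** M0 = g M' ** (M' ** N0 (residue M)) ** M0" by simp
    then have eq': "g M ** M = g M' ** M'"
      by (simp add: M0 flip: matrix_mul_assoc)
    have sub: "(\<lambda>h. h ** M) ` \<Gamma> \<subseteq> (\<lambda>h. h ** M') ` \<Gamma>"
      if eqG: "G ** M = G' ** M'" and G: "G \<in> \<Gamma>" "G' \<in> \<Gamma>" for M M' G G'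
    proof
      fix Y assume "Y \<in> (\<lambda>h. h ** M) ` \<Gamma>"
      then obtain h where h: "h \<in> \<Gamma>" "Y = h ** M" by blast
      obtain G1 where G1: "G1 \<in> \<Gamma>" "G1 ** G = mat 1" using inverse[OF G(1)] by blast
      have "h ** M = h ** ((G1 ** G) ** M)" by (simp add: G1)
      also have "\<dots> = (h ** (G1 ** G')) ** M'" using eqG by (simp flip: matrix_mul_assoc)
      finally show "Y \<in> (\<lambda>h. h ** M') ` \<Gamma>"
        using h mult G1(1) G(2) by blast
    qed
    show "(\<lambda>h. h ** M) ` \<Gamma> = (\<lambda>h. h ** M') ` \<Gamma>"
      using sub[OF eq' g[OF M(1)] g[OF M(2)]] sub[OF eq'[symmetric] g[OF M(2)] g[OF M(1)]] by blast
  qed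
qed

end

section \<open>The complex matrix groups\<close>

abbreviation emb :: "int ^ 4 ^ 4 \<Rightarrow> complex ^ 4 ^ 4" where
  "emb \<equiv> map_matrix of_int"

lemma group_GL4: "group GL4"
proof (rule groupI)
  fix M assume "M \<in> carrier GL4"
  then obtain N where "M ** N = mat 1" "N ** M = mat 1" by (auto simp: GL4_def invertible_def)
  then show "\<exists>N\<in>carrier GL4. N \<otimes>\<^bsub>GL4\<^esub> M = \<one>\<^bsub>GL4\<^esub>"
    by (intro bexI[of _ N]) (auto simp: GL4_def invertible_def)
next
  have "invertible (mat 1 :: complex ^ 4 ^ 4)"
    unfolding invertible_def by (intro exI[of _ "mat 1"]) simp
  then show "\<one>\<^bsub>GL4\<^esub> \<in> carrier GL4" by (simp add: GL4_def)
qed (simp_all add: GL4_def invertible_mult matrix_mul_assoc)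

lemma inv_GL4:
  assumes "M ** N = mat 1" and "N ** M = mat 1"
  shows "inv\<^bsub>GL4\<^esub> M = N"
proof -
  have "M \<in> carrier GL4" "N \<in> carrier GL4" using assms by (auto simp: GL4_def invertible_def)
  then show ?thesis using group.inv_equality[OF group_GL4, of N M] assms by (simp add: GL4_def)
qed

lemma mult_GL4: "M \<otimes>\<^bsub>GL4\<^esub> N = M ** N"
  by (simp add: GL4_def)

lemma one_GL4: "\<one>\<^bsub>GL4\<^esub> = mat 1"
  by (simp add: GL4_def)

lemma subgroup_Sp4Z: "subgroup (carrier (Sp4Z \<Omega>)) GL4"
proof -
  let ?R = "map_matrix of_int :: int ^ 4 ^ 4 \<Rightarrow> rat ^ 4 ^ 4"
  have carrier: "carrier (Sp4Z \<Omega>) = {emb M | M. det M = 1 \<and> preserves_form \<Omega> (?R M)}"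
    by (simp add: Sp4Z_def)
  show ?thesis
    unfolding carrier
  proof (rule group.subgroupI[OF group_GL4])
    show "{emb M | M. det M = 1 \<and> preserves_form \<Omega> (?R M)} \<subseteq> carrier GL4"
    proof clarify
      fix M :: "int ^ 4 ^ 4" assume "det M = 1"
      then obtain N where "M ** N = mat 1" "N ** M = mat 1" by (rule int_matrix_inverse)
      then have "emb M ** emb N = mat 1" "emb N ** emb M = mat 1"
        unfolding map_matrix_of_int_mult[symmetric] by (simp_all add: map_matrix_of_int_one)
      then show "emb M \<in> carrier GL4" by (auto simp: GL4_def invertible_def)
    qed
    have "emb (mat 1) \<in> {emb M | M. det M = 1 \<and> preserves_form \<Omega> (?R M)}"
      by (auto simp: preserves_form_def map_matrix_of_int_one det_I intro!: exI[of _ "mat 1"])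
    then show "{emb M | M. det M = 1 \<and> preserves_form \<Omega> (?R M)} \<noteq> {}" by blast
  next
    fix X assume "X \<in> {emb M | M. det M = 1 \<and> preserves_form \<Omega> (?R M)}"
    then obtain M where M: "X = emb M" "det M = 1" "preserves_form \<Omega> (?R M)" by blast
    obtain N where N: "M ** N = mat 1" "N ** M = mat 1" "det N = 1" using M(2) by (rule int_matrix_inverse)
    have "emb M ** emb N = mat 1" "emb N ** emb M = mat 1"
      unfolding map_matrix_of_int_mult[symmetric] N by (simp_all add: map_matrix_of_int_one)
    then have "inv\<^bsub>GL4\<^esub> X = emb N" unfolding M(1) by (rule inv_GL4)
    moreover have "preserves_form \<Omega> (?R N)"
      unfolding preserves_form_def
    proof (intro allI)
      fix u v
      have "?R M *v (?R N *v u) = u" for u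
        unfolding matrix_vector_mul_assoc map_matrix_of_int_mult[symmetric] N map_matrix_of_int_one by simp
      then show "\<Omega> (?R N *v u) (?R N *v v) = \<Omega> u v"
        using M(3) unfolding preserves_form_def by metis
    qed
    ultimately show "inv\<^bsub>GL4\<^esub> X \<in> {emb M | M. det M = 1 \<and> preserves_form \<Omega> (?R M)}"
      using N(3) by blast
  next
    fix X Y assume "X \<in> {emb M | M. det M = 1 \<and> preserves_form \<Omega> (?R M)}"
      and "Y \<in> {emb M | M. det M = 1 \<and> preserves_form \<Omega> (?R M)}"
    then obtain M N where M: "X = emb M" "det M = 1" "preserves_form \<Omega> (?R M)"
      and N: "Y = emb N" "det N = 1" "preserves_form \<Omega> (?R N)" by blast
    have "X \<otimes>\<^bsub>GL4\<^esub> Y = emb (M ** N)" by (simp add: M N mult_GL4 map_matrix_of_int_mult)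
    moreover have "det (M ** N) = 1" using M N by (simp add: det_mul)
    moreover have "preserves_form \<Omega> (?R (M ** N))"
      using M(3) N(3) by (simp add: preserves_form_def map_matrix_of_int_mult flip: matrix_vector_mul_assoc)
    ultimately show "X \<otimes>\<^bsub>GL4\<^esub> Y \<in> {emb M | M. det M = 1 \<and> preserves_form \<Omega> (?R M)}"
      by blast
  qed
qed

lemma map_matrix_companion:
  "map_matrix of_int (companion [:c0, c1, c2, c3, 1:]) =
    companion [:of_int c0, of_int c1, of_int c2, of_int c3, 1:]"
  by (simp add: companion_quartic vec_eq_iff forall_4)

lemma det_4:
  "det (A :: 'a::comm_ring_1 ^ 4 ^ 4) =
     A$1$1 * (A$2$2 * (A$3$3 * A$4$4 - A$3$4 * A$4$3) - A$2$3 * (A$3$2 * A$4$4 - A$3$4 * A$4$2)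
       + A$2$4 * (A$3$2 * A$4$3 - A$3$3 * A$4$2))
   - A$1$2 * (A$2$1 * (A$3$3 * A$4$4 - A$3$4 * A$4$3) - A$2$3 * (A$3$1 * A$4$4 - A$3$4 * A$4$1)
       + A$2$4 * (A$3$1 * A$4$3 - A$3$3 * A$4$1))
   + A$1$3 * (A$2$1 * (A$3$2 * A$4$4 - A$3$4 * A$4$2) - A$2$2 * (A$3$1 * A$4$4 - A$3$4 * A$4$1)
       + A$2$4 * (A$3$1 * A$4$2 - A$3$2 * A$4$1))
   - A$1$4 * (A$2$1 * (A$3$2 * A$4$3 - A$3$3 * A$4$2) - A$2$2 * (A$3$1 * A$4$3 - A$3$3 * A$4$1)
       + A$2$3 * (A$3$1 * A$4$2 - A$3$2 * A$4$1))"
proof -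
  have f1: "finite {2::4, 3, 4}" "1 \<notin> {2::4, 3, 4}" by auto
  have f2: "finite {3::4, 4}" "2 \<notin> {3::4, 4}" by auto
  have f3: "finite {4::4}" "3 \<notin> {4::4}" by auto
  show ?thesis
    unfolding det_def UNIV_4
    unfolding sum_over_permutations_insert[OF f1]
    unfolding sum_over_permutations_insert[OF f2]
    unfolding sum_over_permutations_insert[OF f3]
    unfolding permutes_sing
    by (simp add: sign_swap_id permutation_swap_id permutation_compose sign_compose sign_id swap_id_eq)
      (simp add: algebra_simps)
qed

lemma det_companion: "det (companion [:1, c1, c2, c3, 1:]) = (1 :: int)"
  by (simp add: det_4 companion_quartic)

section \<open>The invariant form\<close>

text \<open>The rational version of \<open>companion_form\<close>, multiplied out.\<close>

definition rat_form :: "int \<Rightarrow> int \<Rightarrow> rat ^ 4 \<Rightarrow> rat ^ 4 \<Rightarrow> rat" where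
  "rat_form d k u v =
     of_int k * (u$1 * v$2 - u$2 * v$1 + u$2 * v$3 - u$3 * v$2 + u$3 * v$4 - u$4 * v$3)
   + of_int (2 * k - d) * (u$1 * v$3 - u$3 * v$1 + u$2 * v$4 - u$4 * v$2)
   + of_int (3 * k - 4 * d) * (u$1 * v$4 - u$4 * v$1)"

lemma rat_form_of_int:
  "rat_form d k (\<chi> i. of_int (x $ i)) (\<chi> i. of_int (y $ i)) = of_int (companion_form d k x y)"
  by (simp add: rat_form_def companion_form_def to_z4_def) (simp add: algebra_simps)

lemma rat_form_A: "preserves_form (rat_form d k) (map_matrix of_int companion_A)"
  unfolding preserves_form_def map_matrix_companion rat_form_def companion_vector_mult
  by (simp add: algebra_simps)

lemma rat_form_B: "preserves_form (rat_form d k) (map_matrix of_int (companion_B d k))"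
  unfolding preserves_form_def map_matrix_companion rat_form_def companion_vector_mult
  by (simp add: algebra_simps)

text \<open>
  Nondegeneracy: pairing with the four vectors \<open>from_z4 d k\<close> of unit vectors gives, up to sign and the
  factor \<open>d\<close>, the entries of \<open>to_z4 d k u\<close>.
\<close>

lemma symplectic_rat_form:
  assumes d: "d \<noteq> 0"
  shows "symplectic_form (rat_form d k)"
  unfolding symplectic_form_def
proof (intro conjI allI impI)
  fix u v :: "rat ^ 4"
  show "Vector_Spaces.linear (*s) (*) (rat_form d k u)"
    unfolding Vector_Spaces.linear_iff
    by (simp add: vec.vector_space_axioms vector_space_over_itself.vector_space_axioms rat_form_def)
      (simp add: algebra_simps)
  show "Vector_Spaces.linear (*s) (*) (\<lambda>u. rat_form d k u v)"
    unfolding Vector_Spaces.linear_iff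
    by (simp add: vec.vector_space_axioms vector_space_over_itself.vector_space_axioms rat_form_def)
      (simp add: algebra_simps)
  show "rat_form d k u u = 0" by (simp add: rat_form_def)
  assume u: "u \<noteq> 0"
  show "\<exists>v. rat_form d k u v \<noteq> 0"
  proof (rule ccontr)
    assume "\<nexists>v. rat_form d k u v \<noteq> 0"
    then have zero: "rat_form d k u v = 0" for v by blast
    have "rat_form d k u (vector [of_int k, of_int (d - 2 * k), of_int k, 0]) = of_int d * (of_int d * u $ 4)"
      "rat_form d k u (vector [- 1, 3, - 3, 1]) = - (of_int d * (u $ 1 + u $ 2 + u $ 3 + u $ 4))"
      "rat_form d k u (vector [1, - 2, 1, 0]) = - (of_int d * (u $ 1 - u $ 3 - 2 * u $ 4))"
      "rat_form d k u (vector [of_int d, - of_int d, 0, 0]) =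
        of_int d * (of_int d * (u $ 3 + 3 * u $ 4) - of_int k * (u $ 1 + u $ 2 + u $ 3 + u $ 4))"
      by (simp_all add: rat_form_def) (simp_all add: algebra_simps)
    then have "u $ 4 = 0" "u $ 1 + u $ 2 + u $ 3 + u $ 4 = 0" "u $ 1 - u $ 3 - 2 * u $ 4 = 0"
      "of_int d * (u $ 3 + 3 * u $ 4) - of_int k * (u $ 1 + u $ 2 + u $ 3 + u $ 4) = 0"
      using d unfolding zero by simp_all
    then have "u $ 4 = 0" "u $ 3 = 0" "u $ 1 = 0" "u $ 2 = 0" using d by simp_all
    then show False using u by (simp add: vec_eq_iff forall_4)
  qed
qed

lemma integral_rat_form: "integral_form (rat_form d k)"
  by (auto simp: integral_form_def rat_form_def intro!: Ints_add Ints_mult Ints_diff)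

text \<open>
  On the first three basis vectors \<open>A\<close> and \<open>B\<close> shift the indices, so the Gram matrix \<open>w\<close> depends on
  \<open>w 1 2\<close>, \<open>w 1 3\<close>, \<open>w 1 4\<close> only. Applying \<open>A\<close> and \<open>B\<close> to the first and last basis vectors gives two linear
  relations between these three numbers.
\<close>

lemma invariant_form_unique:
  assumes \<Omega>: "symplectic_form \<Omega>" and k: "k \<noteq> 0"
    and A: "preserves_form \<Omega> (map_matrix of_int companion_A)"
    and B: "preserves_form \<Omega> (map_matrix of_int (companion_B d k))"
  shows "\<exists>c. c \<noteq> 0 \<and> (\<forall>u v. \<Omega> u v = c * rat_form d k u v)"
proof -
  have add: "\<Omega> u (v + w) = \<Omega> u v + \<Omega> u w" "\<Omega> (u + v) w = \<Omega> u w + \<Omega> v w"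
    and scale: "\<Omega> u (a *s v) = a * \<Omega> u v" "\<Omega> (a *s u) v = a * \<Omega> u v"
    and self: "\<Omega> u u = 0" for u v w a
    using \<Omega> unfolding symplectic_form_def Vector_Spaces.linear_iff by blast+
  have swap: "\<Omega> v u = - \<Omega> u v" for u v
    using self[of "u + v"] unfolding add by (simp add: self)
  define e :: "4 \<Rightarrow> rat ^ 4" where "e i = axis i 1" for i
  have expand: "u = u$1 *s e 1 + u$2 *s e 2 + u$3 *s e 3 + u$4 *s e 4" for u
    by (simp add: vec_eq_iff forall_4 e_def axis_def)
  define w where "w i j = \<Omega> (e i) (e j)" for i j
  have Ae: "map_matrix of_int companion_A *v e 1 = e 2" "map_matrix of_int companion_A *v e 2 = e 3"
    "map_matrix of_int companion_A *v e 3 = e 4"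
    "map_matrix of_int companion_A *v e 4 = (- 1) *s e 1 + 4 *s e 2 + (- 6) *s e 3 + 4 *s e 4"
    unfolding map_matrix_companion vec_eq_iff forall_4 companion_vector_mult
    by (simp_all add: e_def axis_def)
  have Be: "map_matrix of_int (companion_B d k) *v e 1 = e 2"
    "map_matrix of_int (companion_B d k) *v e 4 = (- 1) *s e 1 + of_int (4 - k) *s e 2
        + of_int (2 * k - d - 6) *s e 3 + of_int (4 - k) *s e 4"
    unfolding map_matrix_companion vec_eq_iff forall_4 companion_vector_mult
    by (simp_all add: e_def axis_def)
  have A': "\<Omega> (map_matrix of_int companion_A *v e i) (map_matrix of_int companion_A *v e j) = w i j" for i j
    using A by (simp add: preserves_form_def w_def)
  have B': "\<Omega> (map_matrix of_int (companion_B d k) *v e i) (map_matrix of_int (companion_B d k) *v e j) = w i j" for i j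
    using B by (simp add: preserves_form_def w_def)
  have w: "w 2 3 = w 1 2" "w 3 4 = w 1 2" "w 2 4 = w 1 3"
    using A'[of 1 2] A'[of 2 3] A'[of 1 3] unfolding Ae by (simp_all add: w_def)
  have a: "w 1 4 = w 1 2 - 6 * w 1 2 + 4 * w 1 3"
    using A'[of 1 4] w self[of "e 2"] swap[of "e 1" "e 2"] unfolding Ae add scale by (simp add: w_def)
  have b: "w 1 4 = w 1 2 + of_int (2 * k - d - 6) * w 1 2 + of_int (4 - k) * w 1 3"
    using B'[of 1 4] w self[of "e 2"] swap[of "e 1" "e 2"] unfolding Be add scale by (simp add: w_def)
  define c where "c = w 1 2 / of_int k"
  have w12: "w 1 2 = c * of_int k" using k by (simp add: c_def)
  have "of_int k * w 1 3 = of_int k * (c * of_int (2 * k - d))"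
    using a b unfolding w12 by (simp add: algebra_simps)
  then have w13: "w 1 3 = c * of_int (2 * k - d)" using k by simp
  have w14: "w 1 4 = c * of_int (3 * k - 4 * d)"
    unfolding a w12 w13 by (simp add: algebra_simps)
  have w_swap: "w 2 1 = - w 1 2" "w 3 1 = - w 1 3" "w 4 1 = - w 1 4" "w 3 2 = - w 2 3"
    "w 4 2 = - w 2 4" "w 4 3 = - w 3 4"
    unfolding w_def by (rule swap)+
  have form: "\<Omega> u v = c * rat_form d k u v" for u v
  proof -
    have "\<Omega> u v = \<Omega> (u$1 *s e 1 + u$2 *s e 2 + u$3 *s e 3 + u$4 *s e 4)
        (v$1 *s e 1 + v$2 *s e 2 + v$3 *s e 3 + v$4 *s e 4)"
      using expand by metis
    also have "\<dots> = w 1 2 * (u$1 * v$2 - u$2 * v$1) + w 2 3 * (u$2 * v$3 - u$3 * v$2)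
        + w 3 4 * (u$3 * v$4 - u$4 * v$3) + w 1 3 * (u$1 * v$3 - u$3 * v$1)
        + w 2 4 * (u$2 * v$4 - u$4 * v$2) + w 1 4 * (u$1 * v$4 - u$4 * v$1)"
      unfolding add scale self w_def[symmetric] w_swap
      by (simp add: algebra_simps)
    also have "\<dots> = c * rat_form d k u v"
      unfolding w w12 w13 w14 rat_form_def by (simp add: algebra_simps)
    finally show ?thesis .
  qed
  moreover have "c \<noteq> 0"
  proof
    assume "c = 0"
    then have "\<Omega> (e 1) v = 0" for v using form by simp
    moreover have "e 1 \<noteq> 0" by (simp add: e_def axis_eq_0_iff)
    ultimately show False using \<Omega> by (auto simp: symplectic_form_def)
  qed
  ultimately show ?thesis by blast
qed

section \<open>Arithmeticity\<close>

theorem arithmetic_companion_group: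
  fixes d k :: int and \<Gamma> :: "(complex ^ 4 ^ 4) set"
  assumes d: "d \<noteq> 0" and k: "k \<noteq> 0"
    and \<Gamma>: "\<Gamma> = generate GL4 {emb companion_A, emb (companion_B d k)}"
    and has_reducing_frame: "\<And>H. hypergeometric_monoid d k H \<Longrightarrow> hypergeometric_monoid.has_reducing_frame H"
  shows "(\<exists>\<Omega>. invariant_symplectic_form \<Gamma> \<Omega>) \<and>
         (\<forall>\<Omega>. invariant_symplectic_form \<Gamma> \<Omega> \<longrightarrow> arithmetic \<Gamma> \<Omega>)"
proof
  let ?R = "map_matrix of_int :: int ^ 4 ^ 4 \<Rightarrow> rat ^ 4 ^ 4"
  let ?gens = "{emb companion_A, emb (companion_B d k)}"
  have carrier: "carrier (Sp4Z \<Omega>) = {emb M | M. det M = 1 \<and> preserves_form \<Omega> (?R M)}" for \<Omega>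
    by (simp add: Sp4Z_def)
  have Sp4Z_eq: "Sp4Z \<Omega> = GL4 \<lparr>carrier := carrier (Sp4Z \<Omega>)\<rparr>" for \<Omega>
    by (simp add: Sp4Z_def)
  have gens: "?gens \<subseteq> carrier (Sp4Z (rat_form d k))"
    unfolding carrier using rat_form_A rat_form_B det_companion by blast
  then have "?gens \<subseteq> carrier GL4" using subgroup.subset[OF subgroup_Sp4Z] by blast
  then have sub: "subgroup \<Gamma> GL4"
    unfolding \<Gamma> by (rule group.generate_is_subgroup[OF group_GL4])
  show "\<exists>\<Omega>. invariant_symplectic_form \<Gamma> \<Omega>"
  proof
    have "\<Gamma> \<subseteq> carrier (Sp4Z (rat_form d k))"
      unfolding \<Gamma> by (rule group.generate_subgroup_incl[OF group_GL4 gens subgroup_Sp4Z])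
    then have "subgroup \<Gamma> (Sp4Z (rat_form d k))"
      by (subst Sp4Z_eq) (rule group.subgroup_incl[OF group_GL4 sub subgroup_Sp4Z])
    then show "invariant_symplectic_form \<Gamma> (rat_form d k)"
      by (simp add: invariant_symplectic_form_def symplectic_rat_form[OF d] integral_rat_form)
  qed
  show "\<forall>\<Omega>. invariant_symplectic_form \<Gamma> \<Omega> \<longrightarrow> arithmetic \<Gamma> \<Omega>"
  proof (intro allI impI)
    fix \<Omega> assume inv: "invariant_symplectic_form \<Gamma> \<Omega>"
    then have symp: "symplectic_form \<Omega>" and "subgroup \<Gamma> (Sp4Z \<Omega>)"
      by (simp_all add: invariant_symplectic_form_def)
    then have incl: "\<Gamma> \<subseteq> carrier (Sp4Z \<Omega>)" by (simp add: subgroup.subset)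
    have gen_in: "emb companion_A \<in> \<Gamma>" "emb (companion_B d k) \<in> \<Gamma>"
      unfolding \<Gamma> by (auto intro: generate.incl)
    have pres: "preserves_form \<Omega> (?R M)" "det M = 1" if "emb M \<in> carrier (Sp4Z \<Omega>)" for M
      using that unfolding carrier by (auto simp: map_matrix_of_int_inject)
    have "preserves_form \<Omega> (?R companion_A)" "preserves_form \<Omega> (?R (companion_B d k))"
      using pres(1) gen_in incl by blast+
    then obtain c where c: "c \<noteq> 0" "\<forall>u v. \<Omega> u v = c * rat_form d k u v"
      using invariant_form_unique[OF symp k] by blast
    have isom: "M \<in> isometries d k" if "emb M \<in> carrier (Sp4Z \<Omega>)" for M
    proof -
      have "companion_form d k (M *v x) (M *v y) = companion_form d k x y" for x y
      proof -
        let ?r = "\<lambda>x :: int ^ 4. (\<chi> i. of_int (x $ i)) :: rat ^ 4"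
        have r: "?R M *v ?r x = ?r (M *v x)" for x
          by (simp add: vec_eq_iff matrix_vector_mult_def)
        have "rat_form d k (?R M *v ?r x) (?R M *v ?r y) = rat_form d k (?r x) (?r y)"
          using pres(1)[OF that] c by (simp add: preserves_form_def)
        then show ?thesis unfolding r rat_form_of_int by simp
      qed
      then show ?thesis using pres(2)[OF that] by (simp add: isometries_def)
    qed
    define \<Gamma>Z where "\<Gamma>Z = {M. emb M \<in> \<Gamma>}"
    have \<Gamma>_eq: "\<Gamma> = emb ` \<Gamma>Z" using incl unfolding carrier \<Gamma>Z_def by blast
    interpret companion_group d k \<Gamma>Z
    proof
      show "d \<noteq> 0" by (rule d)
      show "mat 1 \<in> \<Gamma>Z"
        using subgroup.one_closed[OF sub] by (simp add: \<Gamma>Z_def one_GL4 map_matrix_of_int_one)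
      show "M ** N \<in> \<Gamma>Z" if "M \<in> \<Gamma>Z" "N \<in> \<Gamma>Z" for M N
        using subgroup.m_closed[OF sub, of "emb M" "emb N"] that
        by (simp add: \<Gamma>Z_def mult_GL4 map_matrix_of_int_mult)
      show "\<exists>N\<in>\<Gamma>Z. M ** N = mat 1 \<and> N ** M = mat 1" if "M \<in> \<Gamma>Z" for M
      proof -
        have "emb M \<in> \<Gamma>" using that by (simp add: \<Gamma>Z_def)
        then have "det M = 1" using pres(2) incl by blast
        then obtain N where N: "M ** N = mat 1" "N ** M = mat 1" by (rule int_matrix_inverse)
        have "emb M ** emb N = mat 1" "emb N ** emb M = mat 1"
          unfolding map_matrix_of_int_mult[symmetric] N by (simp_all add: map_matrix_of_int_one)
        then have "inv\<^bsub>GL4\<^esub> (emb M) = emb N" by (rule inv_GL4)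
        then have "N \<in> \<Gamma>Z"
          using subgroup.m_inv_closed[OF sub \<open>emb M \<in> \<Gamma>\<close>] by (simp add: \<Gamma>Z_def)
        then show ?thesis using N by blast
      qed
      show "companion_A \<in> \<Gamma>Z" "companion_B d k \<in> \<Gamma>Z" using gen_in by (simp_all add: \<Gamma>Z_def)
      show "hypergeometric_monoid d k H \<Longrightarrow> hypergeometric_monoid.has_reducing_frame H" for H by (rule has_reducing_frame)
    qed
    have "rcosets\<^bsub>Sp4Z \<Omega>\<^esub> \<Gamma> \<subseteq> (\<lambda>X. emb ` X) ` ((\<lambda>M. (\<lambda>g. g ** M) ` \<Gamma>Z) ` isometries d k)"
    proof
      fix X assume "X \<in> rcosets\<^bsub>Sp4Z \<Omega>\<^esub> \<Gamma>"
      then obtain a where a: "a \<in> carrier (Sp4Z \<Omega>)" "X = \<Gamma> #>\<^bsub>Sp4Z \<Omega>\<^esub> a" by (auto simp: RCOSETS_def)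
      obtain M where M: "a = emb M" using a(1) unfolding carrier by blast
      have "X = emb ` ((\<lambda>g. g ** M) ` \<Gamma>Z)"
        unfolding a(2) M r_coset_def \<Gamma>_eq
        by (auto simp: Sp4Z_def GL4_def map_matrix_of_int_mult image_image)
      then show "X \<in> (\<lambda>X. emb ` X) ` ((\<lambda>M. (\<lambda>g. g ** M) ` \<Gamma>Z) ` isometries d k)"
        using isom a(1) M by blast
    qed
    then have "finite (rcosets\<^bsub>Sp4Z \<Omega>\<^esub> \<Gamma>)"
      by (rule finite_subset) (rule finite_imageI[OF finite_cosets])
    then show "arithmetic \<Gamma> \<Omega>" by (simp add: arithmetic_def)
  qed
qed

section \<open>The characteristic polynomials\<close>

lemma exp_poly_4:
  "exp_poly \<alpha> = [:- exp (2 * of_real pi * \<i> * \<alpha> $ 1), 1:] * [:- exp (2 * of_real pi * \<i> * \<alpha> $ 2), 1:] *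
     [:- exp (2 * of_real pi * \<i> * \<alpha> $ 3), 1:] * [:- exp (2 * of_real pi * \<i> * \<alpha> $ 4), 1:]"
proof -
  have "prod f (UNIV :: 4 set) = f 1 * f 2 * f 3 * f 4" for f :: "4 \<Rightarrow> complex poly"
    unfolding UNIV_4 by (simp add: mult.assoc)
  from this[of "\<lambda>j. [:- exp (2 * of_real pi * \<i> * \<alpha> $ j), 1:]"] show ?thesis
    unfolding exp_poly_def .
qed

text \<open>The two roots are conjugate points of the unit circle.\<close>

lemma conjugate_factors:
  assumes "y = 1 - x"
  shows "[:- exp (2 * of_real pi * \<i> * of_real x), 1:] * [:- exp (2 * of_real pi * \<i> * of_real y), 1:] =
    [:1, - of_real (2 * cos (2 * pi * x)), 1:]"
proof -
  have x: "exp (2 * of_real pi * \<i> * of_real x) = cis (2 * pi * x)"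
    by (simp add: cis_conv_exp mult_ac)
  have "2 * of_real pi * \<i> * of_real y = 2 * of_real pi * \<i> + \<i> * of_real (- (2 * pi * x))"
    by (simp add: assms algebra_simps)
  then have "exp (2 * of_real pi * \<i> * of_real y) = exp (2 * of_real pi * \<i>) * exp (\<i> * of_real (- (2 * pi * x)))"
    by (simp only: exp_add)
  also have "\<dots> = cis (- (2 * pi * x))" by (simp add: cis_conv_exp)
  finally have y: "exp (2 * of_real pi * \<i> * of_real y) = cis (- (2 * pi * x))" .
  have "cis (2 * pi * x) * cis (- (2 * pi * x)) = 1" by (simp add: cis_mult)
  moreover have "cis (2 * pi * x) + cis (- (2 * pi * x)) = of_real (2 * cos (2 * pi * x))"
    by (simp add: complex_eq_iff)
  moreover have "[:- a, 1:] * [:- b, 1:] = [:a * b, - (a + b), 1:]" for a b :: complex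
    by simp
  ultimately show ?thesis unfolding x y by metis
qed

lemma quadratic_3: "[:- exp (2 * of_real pi * \<i> * (1 / 3)), 1:] * [:- exp (2 * of_real pi * \<i> * (2 / 3)), 1:] = [:1, 1, 1:]"
  using conjugate_factors[of "2 / 3" "1 / 3"] cos_120 by simp

lemma quadratic_6: "[:- exp (2 * of_real pi * \<i> * (1 / 6)), 1:] * [:- exp (2 * of_real pi * \<i> * (5 / 6)), 1:] = [:1, - 1, 1:]"
  using conjugate_factors[of "5 / 6" "1 / 6"] cos_60 by simp

lemma quadratic_4: "[:- exp (2 * of_real pi * \<i> * (1 / 4)), 1:] * [:- exp (2 * of_real pi * \<i> * (3 / 4)), 1:] = [:1, 0, 1:]"
proof -
  have "cos (2 * pi * (1 / 4)) = 0" by (simp add: cos_pi_half)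
  moreover have "(3 / 4 :: real) = 1 - 1 / 4" by simp
  note conjugate_factors[OF this]
  ultimately show ?thesis
    by (simp only: of_real_divide of_real_numeral of_real_1 mult_zero_right of_real_0 minus_zero)
qed

lemma hypergeometric_group_eq:
  assumes "exp_poly \<alpha> = [:1, - 4, 6, - 4, 1:]"
    and "exp_poly \<beta> = [:1, of_int (k - 4), of_int (6 + d - 2 * k), of_int (k - 4), 1:]"
  shows "hypergeometric_group \<alpha> \<beta> = generate GL4 {emb companion_A, emb (companion_B d k)}"
  unfolding hypergeometric_group_def map_matrix_companion assms by simp

theorem theorem1p1:
  fixes \<alpha> \<beta> :: "complex ^ 4" and \<Gamma> :: "(complex ^ 4 ^ 4) set"
  assumes "\<alpha> = vector [0, 0, 0, 0]"
    and "\<beta> \<in> {vector [1/3, 1/3, 2/3, 2/3], vector [1/3, 2/3, 1/6, 5/6],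
              vector [1/4, 1/4, 3/4, 3/4], vector [1/3, 2/3, 1/4, 3/4]}"
    and "\<Gamma> = hypergeometric_group \<alpha> \<beta>"
  shows "(\<exists>\<Omega>. invariant_symplectic_form \<Gamma> \<Omega>) \<and>
         (\<forall>\<Omega>. invariant_symplectic_form \<Gamma> \<Omega> \<longrightarrow> arithmetic \<Gamma> \<Omega>)"
proof -
  have f: "exp_poly \<alpha> = [:1, - 4, 6, - 4, 1:]"
    by (simp add: assms(1) exp_poly_4)
  have rearrange: "p * p * q * q = (p * q) * (p * q)" for p q :: "complex poly"
    by (simp add: mult_ac)
  have pair_up: "p * q * r * s = (p * q) * (r * s)" for p q r s :: "complex poly"
    by (simp add: mult_ac)
  from assms(2) consider
      (b1) "\<beta> = vector [1/3, 1/3, 2/3, 2/3]" | (b2) "\<beta> = vector [1/3, 2/3, 1/6, 5/6]"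
    | (b3) "\<beta> = vector [1/4, 1/4, 3/4, 3/4]" | (b4) "\<beta> = vector [1/3, 2/3, 1/4, 3/4]"
    by blast
  then show ?thesis
  proof cases
    case b1
    have "exp_poly \<beta> = [:1, 1, 1:] * [:1, 1, 1:]"
      unfolding exp_poly_4 b1 vector_4 unfolding rearrange unfolding quadratic_3 ..
    then have "\<Gamma> = generate GL4 {emb companion_A, emb (companion_B 9 6)}"
      unfolding assms(3) by (intro hypergeometric_group_eq f) simp
    then show ?thesis by (intro arithmetic_companion_group has_reducing_frame_9_6) auto
  next
    case b2
    have "exp_poly \<beta> = [:1, 1, 1:] * [:1, - 1, 1:]"
      unfolding exp_poly_4 b2 vector_4 unfolding pair_up unfolding quadratic_3 quadratic_6 ..
    then have "\<Gamma> = generate GL4 {emb companion_A, emb (companion_B 3 4)}"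
      unfolding assms(3) by (intro hypergeometric_group_eq f) simp
    then show ?thesis by (intro arithmetic_companion_group has_reducing_frame_3_4) auto
  next
    case b3
    have "exp_poly \<beta> = [:1, 0, 1:] * [:1, 0, 1:]"
      unfolding exp_poly_4 b3 vector_4 unfolding rearrange unfolding quadratic_4 ..
    then have "\<Gamma> = generate GL4 {emb companion_A, emb (companion_B 4 4)}"
      unfolding assms(3) by (intro hypergeometric_group_eq f) simp
    then show ?thesis by (intro arithmetic_companion_group has_reducing_frame_4_4) auto
  next
    case b4
    have "exp_poly \<beta> = [:1, 1, 1:] * [:1, 0, 1:]"
      unfolding exp_poly_4 b4 vector_4 unfolding pair_up unfolding quadratic_3 quadratic_4 ..
    then have "\<Gamma> = generate GL4 {emb companion_A, emb (companion_B 6 5)}"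
      unfolding assms(3) by (intro hypergeometric_group_eq f) simp
    then show ?thesis by (intro arithmetic_companion_group has_reducing_frame_6_5) auto
  qed
qed

end
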